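(* Let $d\ge1$, $\Lambda>0$. For any $x\in[0,1]^d$, let $\mathcal V(x)$ be the hyper-rectangle containing $x$ obtained from a Mondrian tree $\mathrm{MP}(\Lambda)$ on $[0,1]^d$. For $0<\delta\le1-(1-e^{-1})^d$, we have, with probability at least $1-2\delta$, $$\frac{h_+(\mathcal V(x))}{h_-(\mathcal V(x))}\le\frac{5d\log(\delta/d)}{\log(1-\delta)}.$$
   Context: For a hyper-rectangle $A$, $h_-(A)$ and $h_+(A)$ denote its smallest and largest side lengths. Mondrian tree $\mathrm{MP}(\Lambda)$ with lifetime $\Lambda>0$: a random partition of $[0,1]^d$ into hyper-rectangles built recursively, starting from the cell $[0,1]^d$ at time $0$. A cell $C=\prod_{j=1}^d[a_j,b_j]$ born at time $\tau$ waits an exponential time $E$ with rate $\sum_{j=1}^d(b_j-a_j)$. If $\tau+E>\Lambda$, the cell is a leaf of the final partition. Otherwise it is split at time $\tau+E$: a coordinate $J$ is drawn with probability proportional to $b_J-a_J$, the split location is drawn uniformly on $[a_J,b_J]$, and the two resulting cells, born at time $\tau+E$, evolve independently by the same rule. *)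

theory Defs
  imports "HOL-Probability.Probability"
begin

text \<open>A hyper-rectangle is given by its lower and upper corner: the pair \<open>(a, b)\<close> stands for
  \<open>cbox a b\<close>. The dimension is \<open>CARD('d)\<close>, which is at least 1.\<close>

type_synonym 'd cell = "(real ^ 'd) \<times> (real ^ 'd)"

definition unit_cell :: "'d::finite cell" where
  "unit_cell = ((\<chi> j. 0), (\<chi> j. 1))"

text \<open>The truncation at 0 only concerns pairs \<open>(a, b)\<close> with \<open>cbox a b\<close> empty. These never
  arise as cells, but the kernels below have to be subprobability kernels on all arguments.\<close>

definition side_length :: "'d::finite cell \<Rightarrow> 'd \<Rightarrow> real" where
  "side_length C j = max 0 (snd C $ j - fst C $ j)"

definition h_minus :: "'d::finite cell \<Rightarrow> real" where
  "h_minus C = (MIN j. side_length C j)"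

definition h_plus :: "'d::finite cell \<Rightarrow> real" where
  "h_plus C = (MAX j. side_length C j)"

definition split_rate :: "'d::finite cell \<Rightarrow> real" where
  "split_rate C = (\<Sum>j\<in>UNIV. side_length C j)"

text \<open>These three laws are null measures on degenerate cells (all sides of length 0, respectively
  an empty or one-point interval), which occur with probability 0.\<close>

definition waiting_time :: "'d::finite cell \<Rightarrow> real measure" where
  "waiting_time C = density lborel (exponential_density (split_rate C))"

definition split_coordinate :: "'d::finite cell \<Rightarrow> 'd measure" where
  "split_coordinate C = point_measure UNIV (\<lambda>j. ennreal (side_length C j / split_rate C))"

definition split_location :: "'d::finite cell \<Rightarrow> 'd \<Rightarrow> real measure" where
  "split_location C j = uniform_measure lborel {fst C $ j..snd C $ j}"

definition lower_cell :: "'d::finite cell \<Rightarrow> 'd \<Rightarrow> real \<Rightarrow> 'd cell" where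
  "lower_cell C j s = (fst C, (\<chi> i. if i = j then s else snd C $ i))"

definition upper_cell :: "'d::finite cell \<Rightarrow> 'd \<Rightarrow> real \<Rightarrow> 'd cell" where
  "upper_cell C j s = ((\<chi> i. if i = j then s else fst C $ i), snd C)"

text \<open>An inner node carries its split time, split coordinate and split location. The cells are
  not stored: they are determined by the splits on the path from the root.\<close>

type_synonym 'd split_tree = "(real \<times> 'd \<times> real) tree"

definition split_tree_space :: "'d::finite split_tree measure" where
  "split_tree_space = tree_sigma (borel \<Otimes>\<^sub>M (count_space UNIV \<Otimes>\<^sub>M borel))"

text \<open>The law of the tree grown out of a cell \<open>C\<close> born at time \<open>\<tau>\<close>, restricted to the event
  that the recursion stops within \<open>n\<close> levels. The two subtrees are drawn independently.\<close>

primrec mondrian_upto :: "nat \<Rightarrow> real \<Rightarrow> real \<Rightarrow> 'd::finite cell \<Rightarrow> 'd split_tree measure" where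
  "mondrian_upto 0 \<Lambda> \<tau> C = null_measure split_tree_space"
| "mondrian_upto (Suc n) \<Lambda> \<tau> C =
     do {
       E \<leftarrow> waiting_time C;
       if \<tau> + E > \<Lambda> then return split_tree_space Leaf
       else do {
         J \<leftarrow> split_coordinate C;
         s \<leftarrow> split_location C J;
         l \<leftarrow> mondrian_upto n \<Lambda> (\<tau> + E) (lower_cell C J s);
         r \<leftarrow> mondrian_upto n \<Lambda> (\<tau> + E) (upper_cell C J s);
         return split_tree_space (Node l (\<tau> + E, J, s) r)
       }
     }"

text \<open>The increasing limit of these laws; no mass is lost because the recursion almost surely
  stops.\<close>

definition MP :: "real \<Rightarrow> 'd::finite split_tree measure" where
  "MP \<Lambda> = (SUP n. mondrian_upto n \<Lambda> 0 unit_cell)"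

text \<open>The leaf cell containing \<open>x\<close> of the partition of \<open>C\<close> encoded by a tree. A point lying
  exactly on a split (an event of probability 0) is put into the lower cell.\<close>

primrec leaf_cell :: "'d::finite split_tree \<Rightarrow> 'd cell \<Rightarrow> real ^ 'd \<Rightarrow> 'd cell" where
  "leaf_cell Leaf C x = C"
| "leaf_cell (Node l v r) C x =
     (case v of (_, j, s) \<Rightarrow>
        if x $ j \<le> s then leaf_cell l (lower_cell C j s) x
        else leaf_cell r (upper_cell C j s) x)"

definition mondrian_cell :: "'d::finite split_tree \<Rightarrow> real ^ 'd \<Rightarrow> 'd cell" where
  "mondrian_cell T x = leaf_cell T unit_cell x"

end

theory Submission
  imports Defs
begin

text \<open>Everything rests on one formula: if a box \<open>B\<close> contains \<open>x\<close> and lies in the unit cube, then the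
  cell of \<open>x\<close> contains \<open>B\<close> with probability \<open>exp (- \<Lambda> u)\<close>, where \<open>u\<close> is the sum of the side
  lengths of \<open>B\<close>, because splits hit \<open>B\<close> at rate \<open>u\<close>. For \<open>B\<close> a cube of side
  \<open>s = min 1 (- ln (1 - \<delta>) / (d \<Lambda>))\<close> it gives \<open>h_minus \<ge> s\<close> with probability at least \<open>1 - \<delta>\<close>.
  For \<open>B\<close> one of the \<open>2 d\<close> axis-parallel segments of length \<open>v\<close> issuing from \<open>x\<close>, together with a
  union bound, it gives \<open>h_plus \<le> 2 v\<close> with probability at least \<open>1 - \<delta>\<close>, where
  \<open>v = R s / 2\<close> and \<open>R\<close> is the claimed bound on the aspect ratio. If \<open>s = 1\<close>, then \<open>v > 1\<close> and the
  segments leave the cube, so the second event has probability 1.\<close>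

subsection \<open>Measurability of the splitting kernels\<close>

text \<open>The coordinate takes finitely many values, so it can be frozen; for a fixed coordinate
  the map is continuous in the cell and the location.\<close>

lemma measurable_lower_cell [measurable (raw)]:
  assumes [measurable]: "C \<in> borel_measurable M" "s \<in> borel_measurable M"
    and J: "J \<in> M \<rightarrow>\<^sub>M count_space UNIV"
  shows "(\<lambda>\<omega>. lower_cell (C \<omega> :: 'd::finite cell) (J \<omega>) (s \<omega>)) \<in> borel_measurable M"
proof (rule measurable_compose_countable'[OF _ J])
  fix j :: 'd
  have "continuous_on UNIV (\<lambda>p :: 'd cell \<times> real. lower_cell (fst p) j (snd p))"
    unfolding lower_cell_def
    apply (intro continuous_intros)
    subgoal for i by (cases "i = j") (auto intro!: continuous_intros)
    done
  note cont = borel_measurable_continuous_onI[OF this]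
  have "(\<lambda>\<omega>. (C \<omega>, s \<omega>)) \<in> borel_measurable M"
    by (rule borel_measurable_Pair) fact+
  from measurable_compose[OF this cont]
  show "(\<lambda>\<omega>. lower_cell (C \<omega>) j (s \<omega>)) \<in> borel_measurable M"
    by (simp only: fst_conv snd_conv)
qed (auto intro: countable_finite)

lemma measurable_upper_cell [measurable (raw)]:
  assumes [measurable]: "C \<in> borel_measurable M" "s \<in> borel_measurable M"
    and J: "J \<in> M \<rightarrow>\<^sub>M count_space UNIV"
  shows "(\<lambda>\<omega>. upper_cell (C \<omega> :: 'd::finite cell) (J \<omega>) (s \<omega>)) \<in> borel_measurable M"
proof (rule measurable_compose_countable'[OF _ J])
  fix j :: 'd
  have "continuous_on UNIV (\<lambda>p :: 'd cell \<times> real. upper_cell (fst p) j (snd p))"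
    unfolding upper_cell_def
    apply (intro continuous_intros)
    subgoal for i by (cases "i = j") (auto intro!: continuous_intros)
    done
  note cont = borel_measurable_continuous_onI[OF this]
  have "(\<lambda>\<omega>. (C \<omega>, s \<omega>)) \<in> borel_measurable M"
    by (rule borel_measurable_Pair) fact+
  from measurable_compose[OF this cont]
  show "(\<lambda>\<omega>. upper_cell (C \<omega>) j (s \<omega>)) \<in> borel_measurable M"
    by (simp only: fst_conv snd_conv)
qed (auto intro: countable_finite)

lemma measurable_fst_cell [measurable (raw)]:
  assumes C: "C \<in> borel_measurable M"
  shows "(\<lambda>\<omega>. fst (C \<omega> :: 'd::finite cell) $ j) \<in> borel_measurable M"
  by (rule measurable_compose[OF C borel_measurable_continuous_onI])
    (auto intro!: continuous_intros)

lemma measurable_snd_cell [measurable (raw)]: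
  assumes C: "C \<in> borel_measurable M"
  shows "(\<lambda>\<omega>. snd (C \<omega> :: 'd::finite cell) $ j) \<in> borel_measurable M"
  by (rule measurable_compose[OF C borel_measurable_continuous_onI])
    (auto intro!: continuous_intros)

lemma measurable_side_length [measurable (raw)]:
  assumes [measurable]: "C \<in> borel_measurable M"
  shows "(\<lambda>\<omega>. side_length (C \<omega> :: 'd::finite cell) j) \<in> borel_measurable M"
  unfolding side_length_def by measurable

lemma measurable_split_rate [measurable (raw)]:
  assumes [measurable]: "C \<in> borel_measurable M"
  shows "(\<lambda>\<omega>. split_rate (C \<omega> :: 'd::finite cell)) \<in> borel_measurable M"
  unfolding split_rate_def by measurable

section \<open>The three splitting laws as subprobability kernels\<close>

lemma side_length_nonneg [simp]: "0 \<le> side_length C j"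
  by (simp add: side_length_def)

lemma split_rate_nonneg [simp]: "0 \<le> split_rate C"
  by (simp add: split_rate_def sum_nonneg)

lemma sets_waiting_time [simp, measurable_cong]: "sets (waiting_time C) = sets borel"
  by (simp add: waiting_time_def)

lemma space_waiting_time [simp]: "space (waiting_time C) = UNIV"
  by (simp add: waiting_time_def)

lemma sets_split_coordinate [simp, measurable_cong]:
  "sets (split_coordinate C) = sets (count_space UNIV)"
  by (simp add: split_coordinate_def point_measure_def)

lemma space_split_coordinate [simp]: "space (split_coordinate C) = UNIV"
  by (simp add: split_coordinate_def space_point_measure)

lemma sets_split_location [simp, measurable_cong]: "sets (split_location C j) = sets borel"
  by (simp add: split_location_def)

lemma space_split_location [simp]: "space (split_location C j) = UNIV"
  by (simp add: split_location_def)

lemma prob_space_waiting_time: "split_rate C > 0 \<Longrightarrow> prob_space (waiting_time C)"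
  unfolding waiting_time_def by (rule prob_space_exponential_density)

text \<open>At rate 0 the exponential density vanishes identically and the law is the null measure.
  Such total statements are what the bind of the Giry monad asks for, since kernels must be defined
  on all cells.\<close>

lemma subprob_space_waiting_time: "subprob_space (waiting_time C)"
proof (cases "split_rate C = 0")
  case True
  then have "waiting_time C = null_measure lborel"
    by (simp add: waiting_time_def null_measure_eq_density exponential_density_def cong: if_cong)
  then show ?thesis by (simp add: subprob_space_null_measure)
next
  case False
  then show ?thesis
    by (intro prob_space_imp_subprob_space prob_space_waiting_time)
      (simp add: order.not_eq_order_implies_strict)
qed

lemma nn_integral_split_coordinate:
  "(\<integral>\<^sup>+ j. f j \<partial>split_coordinate C) = (\<Sum>j\<in>UNIV. ennreal (side_length C j / split_rate C) * f j)"
  unfolding split_coordinate_def by (subst nn_integral_point_measure_finite) auto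

lemma prob_space_split_coordinate:
  assumes "split_rate C > 0"
  shows "prob_space (split_coordinate C)"
proof
  have "emeasure (split_coordinate C) UNIV = (\<integral>\<^sup>+ j. 1 \<partial>split_coordinate C)"
    by simp
  also have "\<dots> = ennreal (\<Sum>j\<in>UNIV. side_length C j / split_rate C)"
    unfolding nn_integral_split_coordinate by (subst sum_ennreal[symmetric]) auto
  also have "\<dots> = 1"
    using assms by (simp add: sum_divide_distrib[symmetric] split_rate_def)
  finally show "emeasure (split_coordinate C) (space (split_coordinate C)) = 1"
    by simp
qed

lemma subprob_space_split_coordinate: "subprob_space (split_coordinate C)"
proof (cases "split_rate C = 0")
  case True
  have "emeasure (split_coordinate C) UNIV = (\<integral>\<^sup>+ j. 1 \<partial>split_coordinate C)"
    by simp
  also have "\<dots> = 0"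
    unfolding nn_integral_split_coordinate using True by simp
  finally show ?thesis by (intro subprob_spaceI) auto
next
  case False
  then show ?thesis
    by (intro prob_space_imp_subprob_space prob_space_split_coordinate)
      (simp add: order.not_eq_order_implies_strict)
qed

lemma prob_space_split_location:
  assumes "fst C $ j < snd C $ j"
  shows "prob_space (split_location C j)"
  unfolding split_location_def using assms by (intro prob_space_uniform_measure) auto

lemma subprob_space_split_location: "subprob_space (split_location C j)"
proof (cases "fst C $ j < snd C $ j")
  case True
  then show ?thesis by (intro prob_space_imp_subprob_space prob_space_split_location)
next
  case False
  then have "emeasure lborel {fst C $ j..snd C $ j} = 0"
    by (cases "fst C $ j = snd C $ j") auto
  then have "emeasure (split_location C j) UNIV = 0"
    unfolding split_location_def by (subst emeasure_uniform_measure) auto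
  then show ?thesis by (intro subprob_spaceI) auto
qed

lemma measurable_waiting_time [measurable]:
  "waiting_time \<in> borel \<rightarrow>\<^sub>M subprob_algebra (borel :: real measure)"
proof (rule measurable_subprob_algebra)
  fix A :: "real set" assume A [measurable]: "A \<in> sets borel"
  have "(\<lambda>C. \<integral>\<^sup>+ t. ennreal (exponential_density (split_rate C) t) * indicator A t \<partial>lborel)
    \<in> borel_measurable borel"
    unfolding exponential_density_def by measurable
  then show "(\<lambda>C. emeasure (waiting_time C) A) \<in> borel_measurable borel"
    unfolding waiting_time_def by (simp add: emeasure_density)
qed (auto simp: subprob_space_waiting_time)

lemma measurable_split_coordinate [measurable]:
  "split_coordinate \<in> borel \<rightarrow>\<^sub>M subprob_algebra (count_space (UNIV :: 'd::finite set))"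
proof (rule measurable_subprob_algebra)
  fix A :: "'d set"
  have "emeasure (split_coordinate C) A = (\<integral>\<^sup>+ j. indicator A j \<partial>split_coordinate C)" for C
    by simp
  then show "(\<lambda>C. emeasure (split_coordinate C) A) \<in> borel_measurable borel"
    unfolding nn_integral_split_coordinate by simp
qed (auto simp: subprob_space_split_coordinate)

text \<open>The truncation in \<open>side_length\<close> matches the Lebesgue measure of a possibly
  empty interval, which makes the denominator a measurable function of the cell.\<close>

lemma emeasure_split_location:
  "A \<in> sets borel \<Longrightarrow> emeasure (split_location C j) A =
    emeasure lborel ({fst C $ j..snd C $ j} \<inter> A) / ennreal (side_length C j)"
  unfolding split_location_def
  by (subst emeasure_uniform_measure) (auto simp: emeasure_lborel_Icc_eq side_length_def max_def)

text \<open>Written as an integral over a jointly measurable integrand, the numerator becomes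
  measurable in the corners of the cell.\<close>

lemma measurable_split_location':
  "(\<lambda>C. split_location C j) \<in> borel \<rightarrow>\<^sub>M subprob_algebra (borel :: real measure)"
proof (rule measurable_subprob_algebra)
  fix A :: "real set" assume A [measurable]: "A \<in> sets borel"
  have "emeasure lborel ({fst C $ j..snd C $ j} \<inter> A) =
      (\<integral>\<^sup>+ s. (if fst C $ j \<le> s \<and> s \<le> snd C $ j \<and> s \<in> A then 1 else 0) \<partial>lborel)" for C :: "'a cell"
    by (subst nn_integral_indicator[symmetric])
      (auto intro!: nn_integral_cong simp: indicator_def simp del: nn_integral_indicator)
  then show "(\<lambda>C. emeasure (split_location C j) A) \<in> borel_measurable borel"
    by (simp add: emeasure_split_location)
qed (auto simp: subprob_space_split_location)

lemma measurable_split_location [measurable (raw)]: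
  assumes C: "C \<in> borel_measurable M" and J: "J \<in> M \<rightarrow>\<^sub>M count_space UNIV"
  shows "(\<lambda>\<omega>. split_location (C \<omega> :: 'd::finite cell) (J \<omega>)) \<in> M \<rightarrow>\<^sub>M subprob_algebra borel"
  by (rule measurable_compose_countable'[OF _ J])
    (auto intro: countable_finite measurable_compose[OF C measurable_split_location'])

section \<open>Joint measurability of the truncated tree laws\<close>

lemma space_split_tree_space [simp]: "space split_tree_space = UNIV"
  by (simp add: split_tree_space_def space_tree_sigma space_pair_measure)

lemma measurable_Node_split_tree [measurable (raw)]:
  assumes [measurable]: "l \<in> M \<rightarrow>\<^sub>M split_tree_space" "r \<in> M \<rightarrow>\<^sub>M split_tree_space"
    "t \<in> borel_measurable M" "J \<in> M \<rightarrow>\<^sub>M count_space UNIV" "s \<in> borel_measurable M"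
  shows "(\<lambda>\<omega>. Node (l \<omega>) (t \<omega>, J \<omega>, s \<omega>) (r \<omega>)) \<in> M \<rightarrow>\<^sub>M split_tree_space"
  using assms unfolding split_tree_space_def by measurable

text \<open>The recursion is cut into named kernels so that measurability and integrals can be
  handled one layer of binds at a time.\<close>

definition graft :: "nat \<Rightarrow> real \<Rightarrow> 'd::finite cell \<Rightarrow> real \<Rightarrow> 'd \<Rightarrow> real \<Rightarrow> 'd split_tree measure" where
  "graft n \<Lambda> C t J s = do {
     l \<leftarrow> mondrian_upto n \<Lambda> t (lower_cell C J s);
     r \<leftarrow> mondrian_upto n \<Lambda> t (upper_cell C J s);
     return split_tree_space (Node l (t, J, s) r)
   }"

definition split_law :: "nat \<Rightarrow> real \<Rightarrow> 'd::finite cell \<Rightarrow> real \<Rightarrow> 'd split_tree measure" where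
  "split_law n \<Lambda> C t =
    split_coordinate C \<bind> (\<lambda>J. split_location C J \<bind> (\<lambda>s. graft n \<Lambda> C t J s))"

lemma mondrian_upto_Suc:
  "mondrian_upto (Suc n) \<Lambda> \<tau> C = waiting_time C \<bind> (\<lambda>E.
     if \<tau> + E > \<Lambda> then return split_tree_space Leaf else split_law n \<Lambda> C (\<tau> + E))"
  by (simp only: mondrian_upto.simps graft_def split_law_def)

lemma return_Leaf_in_space [measurable]:
  "return split_tree_space Leaf \<in> space (subprob_algebra split_tree_space)"
  by (simp add: space_subprob_algebra subprob_space_return)

context
  fixes n :: nat and \<Lambda> :: real
  \<comment> \<open>This is the induction hypothesis for depth \<open>n\<close>. It is joint in
    birth time and cell because the recursive calls change both at random.\<close>
  assumes K: "(\<lambda>p. mondrian_upto n \<Lambda> (fst p) (snd p :: 'd::finite cell)) \<in>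
    borel \<Otimes>\<^sub>M borel \<rightarrow>\<^sub>M subprob_algebra split_tree_space"
begin

lemma measurable_graft_aux:
  fixes C :: "'m \<Rightarrow> 'd cell"
  assumes [measurable]: "C \<in> borel_measurable M" "t \<in> borel_measurable M"
    "J \<in> M \<rightarrow>\<^sub>M count_space UNIV" "s \<in> borel_measurable M"
  shows "(\<lambda>\<omega>. graft n \<Lambda> (C \<omega>) (t \<omega>) (J \<omega>) (s \<omega>)) \<in> M \<rightarrow>\<^sub>M subprob_algebra split_tree_space"
proof -
  have K' [measurable (raw)]: "(\<lambda>\<omega>. mondrian_upto n \<Lambda> (t \<omega>) (C \<omega>)) \<in> N \<rightarrow>\<^sub>M subprob_algebra split_tree_space"
    if [measurable]: "t \<in> borel_measurable N" "C \<in> borel_measurable N"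
    for t and C :: "_ \<Rightarrow> 'd cell" and N :: "'n measure"
    using measurable_compose[OF _ K, of "\<lambda>\<omega>. (t \<omega>, C \<omega>)" N] by simp
  show ?thesis
    unfolding graft_def
    by (rule measurable_bind, measurable)+
qed

lemma measurable_split_law_aux:
  fixes C :: "'m \<Rightarrow> 'd cell"
  assumes [measurable]: "C \<in> borel_measurable M" "t \<in> borel_measurable M"
  shows "(\<lambda>\<omega>. split_law n \<Lambda> (C \<omega>) (t \<omega>)) \<in> M \<rightarrow>\<^sub>M subprob_algebra split_tree_space"
  unfolding split_law_def
  apply (rule measurable_bind[where N="count_space UNIV"])
  subgoal by measurable
  apply (rule measurable_bind[where N=borel])
  subgoal by measurable
  by (rule measurable_graft_aux; measurable)

lemma measurable_mondrian_upto_Suc_aux: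
  "(\<lambda>p. mondrian_upto (Suc n) \<Lambda> (fst p) (snd p :: 'd cell)) \<in>
    borel \<Otimes>\<^sub>M borel \<rightarrow>\<^sub>M subprob_algebra split_tree_space"
  unfolding mondrian_upto_Suc
  apply (rule measurable_bind[where N=borel])
  subgoal by measurable
  apply (rule measurable_If)
  subgoal by measurable
  subgoal by (rule measurable_split_law_aux; measurable)
  subgoal by measurable
  done

end

lemma measurable_mondrian_upto':
  "(\<lambda>p. mondrian_upto n \<Lambda> (fst p) (snd p :: 'd::finite cell)) \<in>
    borel \<Otimes>\<^sub>M borel \<rightarrow>\<^sub>M subprob_algebra split_tree_space"
proof (induction n)
  case 0
  show ?case by (simp add: subprob_space_null_measure)
qed (rule measurable_mondrian_upto_Suc_aux)

lemma measurable_mondrian_upto [measurable (raw)]: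
  fixes C :: "'m \<Rightarrow> 'd::finite cell"
  assumes [measurable]: "\<tau> \<in> borel_measurable M" "C \<in> borel_measurable M"
  shows "(\<lambda>\<omega>. mondrian_upto n \<Lambda> (\<tau> \<omega>) (C \<omega>)) \<in> M \<rightarrow>\<^sub>M subprob_algebra split_tree_space"
  using measurable_compose[OF _ measurable_mondrian_upto', of "\<lambda>\<omega>. (\<tau> \<omega>, C \<omega>)" M] by simp

lemmas measurable_graft [measurable (raw)] = measurable_graft_aux[OF measurable_mondrian_upto']
  and measurable_split_law [measurable (raw)] = measurable_split_law_aux[OF measurable_mondrian_upto']

lemma mondrian_upto_in_space [measurable]:
  "mondrian_upto n \<Lambda> \<tau> C \<in> space (subprob_algebra split_tree_space)"
  using measurable_space[OF measurable_mondrian_upto', of "(\<tau>, C)" n \<Lambda>]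
  by (simp add: space_pair_measure)

lemma sets_mondrian_upto [simp, measurable_cong]:
  "sets (mondrian_upto n \<Lambda> \<tau> C) = sets split_tree_space"
  using mondrian_upto_in_space[of n \<Lambda> \<tau> C] by (simp add: space_subprob_algebra)

lemma space_mondrian_upto [simp]: "space (mondrian_upto n \<Lambda> \<tau> C) = UNIV"
  using sets_eq_imp_space_eq[OF sets_mondrian_upto] by simp

lemma subprob_space_mondrian_upto: "subprob_space (mondrian_upto n \<Lambda> \<tau> C)"
  using mondrian_upto_in_space[of n \<Lambda> \<tau> C] by (simp add: space_subprob_algebra)

section \<open>Integrals against the truncated tree laws\<close>

lemma nn_integral_graft:
  assumes [measurable]: "g \<in> borel_measurable split_tree_space"
  shows "(\<integral>\<^sup>+ T. g T \<partial>graft n \<Lambda> C t J s) =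
    (\<integral>\<^sup>+ l. \<integral>\<^sup>+ r. g (Node l (t, J, s) r)
        \<partial>mondrian_upto n \<Lambda> t (upper_cell C J s) \<partial>mondrian_upto n \<Lambda> t (lower_cell C J s))"
  unfolding graft_def
  apply (subst nn_integral_bind[where B=split_tree_space])
    apply measurable
  apply (subst nn_integral_bind[where B=split_tree_space])
    apply measurable
  apply (subst nn_integral_return)
    apply (simp_all)
  done

lemma nn_integral_split_law:
  assumes [measurable]: "g \<in> borel_measurable split_tree_space"
  shows "(\<integral>\<^sup>+ T. g T \<partial>split_law n \<Lambda> C t) =
    (\<integral>\<^sup>+ J. \<integral>\<^sup>+ s. \<integral>\<^sup>+ T. g T \<partial>graft n \<Lambda> C t J s \<partial>split_location C J \<partial>split_coordinate C)"
  unfolding split_law_def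
  apply (subst nn_integral_bind[where B=split_tree_space])
  subgoal by measurable
  subgoal by (rule measurable_bind[where N=borel]; measurable)
  apply (intro nn_integral_cong)
  apply (rule nn_integral_bind[where B=split_tree_space])
  subgoal by measurable
  subgoal by measurable
  done

lemma nn_integral_mondrian_upto_Suc:
  assumes [measurable]: "g \<in> borel_measurable split_tree_space"
  shows "(\<integral>\<^sup>+ T. g T \<partial>mondrian_upto (Suc n) \<Lambda> \<tau> C) =
    (\<integral>\<^sup>+ E. (if \<tau> + E > \<Lambda> then g Leaf else \<integral>\<^sup>+ T. g T \<partial>split_law n \<Lambda> C (\<tau> + E)) \<partial>waiting_time C)"
  unfolding mondrian_upto_Suc
  apply (subst nn_integral_bind[where B=split_tree_space])
    apply measurable
  apply (intro nn_integral_cong)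
  apply (auto simp: nn_integral_return)
  done


subsection \<open>The limit law\<close>

declare mondrian_upto.simps(2) [simp del]

text \<open>A deeper truncation admits more trees and changes no weights; the induction compares the
  laws on each measurable set.\<close>

lemma mondrian_upto_mono: "mondrian_upto n \<Lambda> \<tau> C \<le> mondrian_upto (Suc n) \<Lambda> \<tau> C"
proof (induction n arbitrary: \<tau> C)
  case 0
  show ?case
    by (subst le_measure) simp_all
next
  case (Suc n)
  have "emeasure (mondrian_upto (Suc n) \<Lambda> \<tau> C) A \<le> emeasure (mondrian_upto (Suc (Suc n)) \<Lambda> \<tau> C) A"
    if [measurable]: "A \<in> sets split_tree_space" for A
  proof -
    have graft: "(\<integral>\<^sup>+ T. indicator A T \<partial>graft n \<Lambda> C t J s)
        \<le> (\<integral>\<^sup>+ T. indicator A T \<partial>graft (Suc n) \<Lambda> C t J s)" for t J s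
    proof -
      let ?I = "\<lambda>m k. \<integral>\<^sup>+ l. \<integral>\<^sup>+ r. indicator A (Node l (t, J, s) r)
        \<partial>mondrian_upto m \<Lambda> t (upper_cell C J s) \<partial>mondrian_upto k \<Lambda> t (lower_cell C J s)"
      \<comment> \<open>The two subtree laws are enlarged one after the other: first the inner one,
        then the outer one.\<close>
      have "?I n n \<le> ?I (Suc n) n"
        by (intro nn_integral_mono nn_integral_mono_measure Suc) simp
      also have "\<dots> \<le> ?I (Suc n) (Suc n)"
        by (intro nn_integral_mono_measure Suc) simp
      finally show ?thesis
        by (simp add: nn_integral_graft)
    qed
    have "(\<integral>\<^sup>+ T. indicator A T \<partial>mondrian_upto (Suc n) \<Lambda> \<tau> C)
      \<le> (\<integral>\<^sup>+ T. indicator A T \<partial>mondrian_upto (Suc (Suc n)) \<Lambda> \<tau> C)"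
      unfolding nn_integral_mondrian_upto_Suc[OF borel_measurable_indicator[OF that]]
        nn_integral_split_law[OF borel_measurable_indicator[OF that]]
      by (intro nn_integral_mono if_mono order_refl) (auto intro!: nn_integral_mono graft)
    then show ?thesis by (simp add: that)
  qed
  then show ?case by (subst le_measure) auto
qed

text \<open>A supremum of measures need not be computed setwise in general; along a chain it is, and
  monotonicity in the depth provides the chain.\<close>

lemma
  shows sets_MP: "sets (MP \<Lambda> :: 'd::finite split_tree measure) = sets split_tree_space"
    and emeasure_MP: "A \<in> sets split_tree_space \<Longrightarrow>
      emeasure (MP \<Lambda> :: 'd split_tree measure) A = (SUP n. emeasure (mondrian_upto n \<Lambda> 0 unit_cell) A)"
proof -
  have inc: "incseq (\<lambda>n. mondrian_upto n \<Lambda> 0 (unit_cell :: 'd cell))"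
    by (intro incseq_SucI mondrian_upto_mono)
  show "sets (MP \<Lambda> :: 'd split_tree measure) = sets split_tree_space"
    unfolding MP_def by (rule sets_SUP) simp_all
  have chain: "Complete_Partial_Order.chain (\<le>) (range (\<lambda>n. mondrian_upto n \<Lambda> 0 (unit_cell :: 'd cell)))"
    unfolding Complete_Partial_Order.chain_def
  proof safe
    fix m n
    assume "\<not> mondrian_upto n \<Lambda> 0 unit_cell \<le> mondrian_upto m \<Lambda> 0 (unit_cell :: 'd cell)"
    with incseqD[OF inc] nat_le_linear[of m n]
    show "mondrian_upto m \<Lambda> 0 unit_cell \<le> mondrian_upto n \<Lambda> 0 (unit_cell :: 'd cell)"
      by blast
  qed
  assume "A \<in> sets split_tree_space"
  with chain show "emeasure (MP \<Lambda> :: 'd split_tree measure) A = (SUP n. emeasure (mondrian_upto n \<Lambda> 0 unit_cell) A)"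
    unfolding MP_def
    by (intro emeasure_SUP_chain[where N=split_tree_space]) auto
qed

text \<open>The recursion of \<open>leaf_cell\<close> changes the cell, so it is not covered by the library rule for
  measurability of primitive recursion on trees. Truncating it at a fixed depth reduces the claim to
  induction on that depth.\<close>

primrec leaf_upto :: "nat \<Rightarrow> 'd::finite split_tree \<Rightarrow> 'd cell \<Rightarrow> real ^ 'd \<Rightarrow> 'd cell" where
  "leaf_upto 0 T C x = C"
| "leaf_upto (Suc n) T C x = (case T of Leaf \<Rightarrow> C | Node l v r \<Rightarrow>
     if x $ fst (snd v) \<le> snd (snd v) then leaf_upto n l (lower_cell C (fst (snd v)) (snd (snd v))) x
     else leaf_upto n r (upper_cell C (fst (snd v)) (snd (snd v))) x)"

lemma leaf_upto_eq: "height T \<le> n \<Longrightarrow> leaf_upto n T C x = leaf_cell T C x"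
proof (induction T arbitrary: n C)
  case Leaf
  show ?case by (cases n) auto
next
  case (Node l v r)
  then show ?case by (cases n) (auto split: prod.splits)
qed

text \<open>Tree and cell are treated as a joint argument because each level passes a modified cell
  to a subtree.\<close>

lemma measurable_leaf_upto:
  "(\<lambda>p. leaf_upto n (fst p) (snd p) (x :: real ^ 'd::finite)) \<in>
    borel_measurable (split_tree_space \<Otimes>\<^sub>M borel)"
proof (induction n)
  case (Suc n)
  let ?V = "borel \<Otimes>\<^sub>M (count_space UNIV \<Otimes>\<^sub>M borel) :: (real \<times> 'd \<times> real) measure"
  let ?M = "split_tree_space \<Otimes>\<^sub>M borel :: ('d split_tree \<times> 'd cell) measure"
  let ?N = "?M \<Otimes>\<^sub>M tree_sigma ?V \<Otimes>\<^sub>M ?V \<Otimes>\<^sub>M tree_sigma ?V"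
  have IH: "(\<lambda>\<omega>. leaf_upto n (T \<omega>) (C \<omega>) x) \<in> borel_measurable ?N"
    if "T \<in> ?N \<rightarrow>\<^sub>M tree_sigma ?V" "C \<in> borel_measurable ?N" for T C
  proof -
    have "(\<lambda>\<omega>. (T \<omega>, C \<omega>)) \<in> ?N \<rightarrow>\<^sub>M (split_tree_space \<Otimes>\<^sub>M borel)"
      using that by (intro measurable_Pair) (simp_all add: split_tree_space_def)
    from measurable_compose[OF this Suc.IH] show ?thesis by simp
  qed
  show ?case
    unfolding leaf_upto.simps
  proof (rule measurable_case_tree[where M="?V"])
    show "fst \<in> ?M \<rightarrow>\<^sub>M tree_sigma ?V"
      unfolding split_tree_space_def by measurable
    show "(\<lambda>(\<omega>, l, v, r). if x $ fst (snd v) \<le> snd (snd v)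
        then leaf_upto n l (lower_cell (snd \<omega>) (fst (snd v)) (snd (snd v))) x
        else leaf_upto n r (upper_cell (snd \<omega>) (fst (snd v)) (snd (snd v))) x) \<in> ?N \<rightarrow>\<^sub>M borel"
      unfolding split_beta'
      apply (rule measurable_If)
      subgoal by (rule IH; measurable)
      subgoal by (rule IH; measurable)
      subgoal by measurable
      done
  qed measurable
qed simp

text \<open>For every tree the truncations are constant from its height on, so this is a pointwise
  limit of measurable functions.\<close>

lemma measurable_leaf_cell [measurable (raw)]:
  assumes "T \<in> M \<rightarrow>\<^sub>M split_tree_space" "C \<in> borel_measurable M"
  shows "(\<lambda>\<omega>. leaf_cell (T \<omega>) (C \<omega>) (x :: real ^ 'd::finite)) \<in> borel_measurable M"
proof (rule borel_measurable_LIMSEQ_metric)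
  show "(\<lambda>\<omega>. leaf_upto n (T \<omega>) (C \<omega>) x) \<in> borel_measurable M" for n
    using measurable_compose[OF measurable_Pair[OF assms] measurable_leaf_upto] by simp
  show "(\<lambda>n. leaf_upto n (T \<omega>) (C \<omega>) x) \<longlonglongrightarrow> leaf_cell (T \<omega>) (C \<omega>) x" for \<omega>
    by (rule tendsto_eventually, rule eventually_sequentiallyI[of "height (T \<omega>)"])
      (rule leaf_upto_eq)
qed

subsection \<open>One split seen from a point\<close>

text \<open>The tie at \<open>s\<close> is broken as in \<open>leaf_cell\<close>, so the descent
  towards \<open>x\<close> continues in this child; the other child will enter only through its
  total mass.\<close>

definition near_cell :: "'d::finite cell \<Rightarrow> 'd \<Rightarrow> real \<Rightarrow> real ^ 'd \<Rightarrow> 'd cell" where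
  "near_cell C j s x = (if x $ j \<le> s then lower_cell C j s else upper_cell C j s)"

definition far_cell :: "'d::finite cell \<Rightarrow> 'd \<Rightarrow> real \<Rightarrow> real ^ 'd \<Rightarrow> 'd cell" where
  "far_cell C j s x = (if x $ j \<le> s then upper_cell C j s else lower_cell C j s)"

text \<open>On such cells all three splitting laws are probability measures, so the null-measure
  conventions for degenerate cells stay out of the computations.\<close>

definition proper_cell :: "'d::finite cell \<Rightarrow> bool" where
  "proper_cell C \<longleftrightarrow> (\<forall>j. fst C $ j < snd C $ j)"

definition cells_around :: "real ^ 'd::finite \<Rightarrow> real ^ 'd \<Rightarrow> 'd cell set" where
  "cells_around lo hi = {C. \<forall>j. fst C $ j \<le> lo $ j \<and> hi $ j \<le> snd C $ j}"

lemma cells_around_borel [measurable]: "cells_around lo hi \<in> sets (borel :: 'd::finite cell measure)"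
proof -
  have "Measurable.pred (borel :: 'd cell measure) (\<lambda>C. \<forall>j. fst C $ j \<le> lo $ j \<and> hi $ j \<le> snd C $ j)"
    by measurable
  then show ?thesis by (simp add: cells_around_def pred_def)
qed

lemma split_rate_pos: "proper_cell C \<Longrightarrow> 0 < split_rate C"
  unfolding split_rate_def
  by (intro sum_pos) (auto simp: side_length_def proper_cell_def)

lemma proper_child:
  assumes "proper_cell C" "fst C $ j < s" "s < snd C $ j"
  shows "proper_cell (near_cell C j s x)" "proper_cell (far_cell C j s x)"
  using assms by (auto simp: near_cell_def far_cell_def lower_cell_def upper_cell_def proper_cell_def)

lemma split_rate_child:
  assumes "fst C $ j < s" "s < snd C $ j"
  shows "split_rate (near_cell C j s x) \<le> split_rate C" "split_rate (far_cell C j s x) \<le> split_rate C"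
  using assms unfolding split_rate_def
  by (auto simp: near_cell_def far_cell_def lower_cell_def upper_cell_def side_length_def intro!: sum_mono)

text \<open>Endpoints are Lebesgue null sets. Hence almost every split of a proper cell has proper
  children, which is what the inductions over the depth need.\<close>

lemma AE_split_location:
  assumes "fst C $ j < snd C $ j"
  shows "AE s in split_location C j. fst C $ j < s \<and> s < snd C $ j"
  unfolding split_location_def
  apply (subst AE_uniform_measure)
  using assms AE_lborel_singleton[of "fst C $ j"] AE_lborel_singleton[of "snd C $ j"]
    apply auto
  done

lemma near_cell_in_around_iff:
  assumes "C \<in> cells_around lo hi"
  shows "near_cell C j s x \<in> cells_around lo hi \<longleftrightarrow> (if x $ j \<le> s then hi $ j \<le> s else s \<le> lo $ j)"
  using assms by (auto simp: near_cell_def cells_around_def lower_cell_def upper_cell_def)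

text \<open>Splitting only shrinks a cell, so a box that has been lost is never regained.\<close>

lemma near_cell_notin_around:
  assumes "C \<notin> cells_around lo hi" "fst C $ j < s" "s < snd C $ j"
  shows "near_cell C j s x \<notin> cells_around lo hi"
  using assms by (force simp: near_cell_def cells_around_def lower_cell_def upper_cell_def split: if_splits)

text \<open>The case distinction mirrors the tie-breaking of \<open>leaf_cell\<close>: a split located exactly at \<open>x\<close>
  keeps the lower part, which loses the box unless \<open>h = x\<close>.\<close>

lemma emeasure_split_avoids:
  fixes a b l h x :: real
  assumes "a \<le> l" "l \<le> x" "x \<le> h" "h \<le> b"
  shows "emeasure lborel {s \<in> {a..b}. if x \<le> s then h \<le> s else s \<le> l} = ennreal ((b - a) - (h - l))"
proof (cases "l = x")
  case True
  have "{s \<in> {a..b}. if x \<le> s then h \<le> s else s \<le> l} = {a..<x} \<union> {h..b}"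
    using assms True by (auto split: if_splits)
  also have "emeasure lborel \<dots> = emeasure lborel {a..<x} + emeasure lborel {h..b}"
    using assms True by (intro plus_emeasure[symmetric]) auto
  also have "\<dots> = ennreal ((b - a) - (h - l))"
    using assms True by (simp add: ennreal_plus[symmetric] del: ennreal_plus)
  finally show ?thesis .
next
  case False
  have "{s \<in> {a..b}. if x \<le> s then h \<le> s else s \<le> l} = {a..l} \<union> {h..b}"
    using assms False by (auto split: if_splits)
  also have "emeasure lborel \<dots> = emeasure lborel {a..l} + emeasure lborel {h..b}"
    using assms False by (intro plus_emeasure[symmetric]) auto
  also have "\<dots> = ennreal ((b - a) - (h - l))"
    using assms False by (simp add: ennreal_plus[symmetric] del: ennreal_plus)
  finally show ?thesis .
qed

text \<open>Coordinate \<open>j\<close> is drawn with weight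
  \<open>side_length C j / split_rate C\<close>, and the location then spares the box with
  probability one minus the quotient of the two side lengths. The side length of \<open>C\<close>
  cancels, and summing over \<open>j\<close> leaves one minus the ratio of the rates.\<close>

lemma nn_integral_near_cell:
  assumes C: "proper_cell C" "C \<in> cells_around lo hi"
    and x: "\<forall>j. lo $ j \<le> x $ j \<and> x $ j \<le> hi $ j"
  shows "(\<integral>\<^sup>+ J. \<integral>\<^sup>+ s. indicator (cells_around lo hi) (near_cell C J s x)
      \<partial>split_location C J \<partial>split_coordinate C)
    = ennreal (1 - (\<Sum>j\<in>UNIV. hi $ j - lo $ j) / split_rate C)"
proof -
  note r = split_rate_pos[OF C(1)]
  have len: "side_length C j = snd C $ j - fst C $ j" "side_length C j > 0" for j
    using C(1) by (auto simp: proper_cell_def side_length_def max_def less_imp_le)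
  have box: "fst C $ j \<le> lo $ j" "hi $ j \<le> snd C $ j" for j
    using C(2) by (auto simp: cells_around_def)
  have "(\<integral>\<^sup>+ s. indicator (cells_around lo hi) (near_cell C J s x) \<partial>split_location C J)
    = ennreal ((side_length C J - (hi $ J - lo $ J)) / side_length C J)" for J
  proof -
    let ?S = "{s. if x $ J \<le> s then hi $ J \<le> s else s \<le> lo $ J}"
    have "(\<integral>\<^sup>+ s. indicator (cells_around lo hi) (near_cell C J s x) \<partial>split_location C J)
      = (\<integral>\<^sup>+ s. indicator ?S s \<partial>split_location C J)"
      by (intro nn_integral_cong) (simp add: indicator_def near_cell_in_around_iff[OF C(2)])
    also have "\<dots> = emeasure (split_location C J) ?S"
      by (intro nn_integral_indicator) simp
    also have "\<dots> = emeasure lborel ({fst C $ J..snd C $ J} \<inter> ?S) / ennreal (side_length C J)"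
      by (intro emeasure_split_location) simp
    also have "{fst C $ J..snd C $ J} \<inter> ?S =
        {s \<in> {fst C $ J..snd C $ J}. if x $ J \<le> s then hi $ J \<le> s else s \<le> lo $ J}"
      by auto
    also have "emeasure lborel \<dots> = ennreal (side_length C J - (hi $ J - lo $ J))"
      using x box len by (subst emeasure_split_avoids) auto
    also have "\<dots> / ennreal (side_length C J) = ennreal ((side_length C J - (hi $ J - lo $ J)) / side_length C J)"
      using len[of J] box[of J] by (intro divide_ennreal) auto
    finally show ?thesis .
  qed
  then have "(\<integral>\<^sup>+ J. \<integral>\<^sup>+ s. indicator (cells_around lo hi) (near_cell C J s x)
      \<partial>split_location C J \<partial>split_coordinate C)
    = (\<Sum>j\<in>UNIV. ennreal (side_length C j / split_rate C) *
         ennreal ((side_length C j - (hi $ j - lo $ j)) / side_length C j))"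
    by (simp add: nn_integral_split_coordinate)
  also have "\<dots> = (\<Sum>j\<in>UNIV. ennreal ((side_length C j - (hi $ j - lo $ j)) / split_rate C))"
  proof (intro sum.cong refl)
    fix j :: 'a
    show "ennreal (side_length C j / split_rate C) *
         ennreal ((side_length C j - (hi $ j - lo $ j)) / side_length C j)
       = ennreal ((side_length C j - (hi $ j - lo $ j)) / split_rate C)"
      using len[of j] r by (subst ennreal_mult'[symmetric]) auto
  qed
  also have "\<dots> = ennreal (\<Sum>j\<in>UNIV. (side_length C j - (hi $ j - lo $ j)) / split_rate C)"
    using len box by (intro sum_ennreal) (simp add: add_mono diff_mono)
  also have "(\<Sum>j\<in>UNIV. (side_length C j - (hi $ j - lo $ j)) / split_rate C)
      = 1 - (\<Sum>j\<in>UNIV. hi $ j - lo $ j) / split_rate C"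
    using r by (simp add: sum_divide_distrib[symmetric] sum_subtractf split_rate_def diff_divide_distrib)
  finally show ?thesis .
qed

section \<open>Exponential waiting times\<close>

text \<open>The sign of \<open>v\<close> is left open to serve both applications:
  \<open>v = - u\<close> for the survival of a box of total side length \<open>u\<close>, and
  \<open>v = 4 * D\<close> for the truncation error.\<close>

lemma nn_integral_waiting_time_exp:
  assumes r: "split_rate C > 0" and v: "split_rate C + v > 0" and "\<tau> \<le> \<Lambda>"
  shows "(\<integral>\<^sup>+ E. (if \<tau> + E > \<Lambda> then 0 else ennreal (exp (v * (\<Lambda> - (\<tau> + E))))) \<partial>waiting_time C)
    = ennreal (split_rate C / (split_rate C + v) * (exp (v * (\<Lambda> - \<tau>)) - exp (- split_rate C * (\<Lambda> - \<tau>))))"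
proof -
  define r where "r = split_rate C"
  define T where "T = \<Lambda> - \<tau>"
  have T: "T \<ge> 0" and r0: "r > 0" and rv: "r + v > 0"
    using assms by (auto simp: T_def r_def)
  have "(\<integral>\<^sup>+ E. (if \<tau> + E > \<Lambda> then 0 else ennreal (exp (v * (\<Lambda> - (\<tau> + E))))) \<partial>waiting_time C)
    = (\<integral>\<^sup>+ E. ennreal (exponential_density r E) *
        (if \<tau> + E > \<Lambda> then 0 else ennreal (exp (v * (\<Lambda> - (\<tau> + E))))) \<partial>lborel)"
    unfolding waiting_time_def r_def by (subst nn_integral_density) auto
  also have "\<dots> = (\<integral>\<^sup>+ E. ennreal (r * exp (v * T - (r + v) * E)) * indicator {0..T} E \<partial>lborel)"
    using r0 by (intro nn_integral_cong)
      (auto simp: exponential_density_def T_def indicator_def ennreal_mult'[symmetric]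
        exp_add[symmetric] algebra_simps)
  also have "\<dots> = ennreal (- r / (r + v) * exp (v * T - (r + v) * T) - (- r / (r + v) * exp (v * T - (r + v) * 0)))"
  proof (intro nn_integral_FTC_Icc)
    show "((\<lambda>E. - r / (r + v) * exp (v * T - (r + v) * E)) has_real_derivative
        r * exp (v * T - (r + v) * E)) (at E)" for E
    proof -
      have "((\<lambda>E. exp (v * T - (r + v) * E)) has_real_derivative
          exp (v * T - (r + v) * E) * - (r + v)) (at E)"
        by (auto intro!: derivative_eq_intros)
      from DERIV_cmult[OF this, of "- r / (r + v)"]
      have "((\<lambda>E. - r / (r + v) * exp (v * T - (r + v) * E)) has_real_derivative
          - r / (r + v) * (exp (v * T - (r + v) * E) * - (r + v))) (at E)" .
      moreover have "- r / (r + v) * (e * - (r + v)) = r * e" for e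
        using rv by (simp add: divide_simps) (simp add: algebra_simps)
      ultimately show ?thesis by (simp only:)
    qed
  qed (use r0 T in auto)
  also have "- r / (r + v) * exp (v * T - (r + v) * T) - (- r / (r + v) * exp (v * T - (r + v) * 0))
    = r / (r + v) * (exp (v * T) - exp (- r * T))"
    by (simp add: algebra_simps)
  finally show ?thesis by (simp add: r_def T_def)
qed

lemma nn_integral_waiting_time_gt:
  assumes r: "split_rate C > 0" and "\<tau> \<le> \<Lambda>"
  shows "(\<integral>\<^sup>+ E. (if \<tau> + E > \<Lambda> then 1 else 0) \<partial>waiting_time C) = ennreal (exp (- split_rate C * (\<Lambda> - \<tau>)))"
proof -
  define r where "r = split_rate C"
  define T where "T = \<Lambda> - \<tau>"
  have T: "T \<ge> 0" and r0: "r > 0"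
    using assms by (auto simp: T_def r_def)
  have "(\<integral>\<^sup>+ E. (if \<tau> + E > \<Lambda> then 1 else 0) \<partial>waiting_time C)
    = (\<integral>\<^sup>+ E. ennreal (exponential_density r E) * (if \<tau> + E > \<Lambda> then 1 else 0) \<partial>lborel)"
    unfolding waiting_time_def r_def by (subst nn_integral_density) auto
  \<comment> \<open>Passing from the open to the closed half-line changes the integrand only at the
    null point \<open>T\<close>, and gives the form required by the fundamental theorem of
    calculus.\<close>
  also have "\<dots> = (\<integral>\<^sup>+ E. ennreal (r * exp (- r * E)) * indicator {T..} E \<partial>lborel)"
    using T AE_lborel_singleton[of T]
    by (intro nn_integral_cong_AE)
      (auto elim!: eventually_mono simp: exponential_density_def T_def indicator_def algebra_simps)
  also have "\<dots> = ennreal (0 - (- exp (- r * T)))"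
  proof (intro nn_integral_FTC_atLeast)
    have "((\<lambda>x. - exp (- r * x)) \<longlongrightarrow> - 0) at_top"
      using r0 by (intro tendsto_minus) real_asymp
    then show "((\<lambda>x. - exp (- r * x)) \<longlongrightarrow> 0) at_top" by simp
  qed (use r0 in \<open>auto intro!: derivative_eq_intros\<close>)
  finally show ?thesis by (simp add: r_def T_def)
qed

text \<open>The survival probability \<open>exp (- u * (\<Lambda> - \<tau>))\<close> is a fixed
  point of conditioning on the first split: either the lifetime ends first, or the split spares the
  box with probability \<open>1 - u / split_rate C\<close> and the process restarts with the
  remaining lifetime.\<close>

lemma waiting_time_survival:
  assumes r: "split_rate C > 0" and u: "0 \<le> u" "u \<le> split_rate C" and "\<tau> \<le> \<Lambda>"
  shows "(\<integral>\<^sup>+ E. (if \<tau> + E > \<Lambda> then 1 else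
      ennreal (1 - u / split_rate C) * ennreal (exp (- u * (\<Lambda> - (\<tau> + E))))) \<partial>waiting_time C)
    = ennreal (exp (- u * (\<Lambda> - \<tau>)))"
proof -
  let ?r = "split_rate C"
  have "(\<integral>\<^sup>+ E. (if \<tau> + E > \<Lambda> then 1 else
      ennreal (1 - u / ?r) * ennreal (exp (- u * (\<Lambda> - (\<tau> + E))))) \<partial>waiting_time C)
    = (\<integral>\<^sup>+ E. (if \<tau> + E > \<Lambda> then 1 else 0) + ennreal (1 - u / ?r) *
       (if \<tau> + E > \<Lambda> then 0 else ennreal (exp (- u * (\<Lambda> - (\<tau> + E))))) \<partial>waiting_time C)"
    by (intro nn_integral_cong) auto
  also have "\<dots> = ennreal (exp (- ?r * (\<Lambda> - \<tau>))) + ennreal (1 - u / ?r) *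
     (\<integral>\<^sup>+ E. (if \<tau> + E > \<Lambda> then 0 else ennreal (exp (- u * (\<Lambda> - (\<tau> + E))))) \<partial>waiting_time C)"
    using assms by (subst nn_integral_add, simp, simp, subst nn_integral_cmult)
      (simp_all add: nn_integral_waiting_time_gt)
  also have "\<dots> = ennreal (exp (- u * (\<Lambda> - \<tau>)))"
  \<comment> \<open>If the box fills the cell, every split hits it and the second summand vanishes.
    This case is separate because the closed form divides by \<open>?r - u\<close>.\<close>
  proof (cases "u = ?r")
    case True
    then show ?thesis using r by simp
  next
    case False
    then have "?r + - u > 0" using u by simp
    from nn_integral_waiting_time_exp[OF r this \<open>\<tau> \<le> \<Lambda>\<close>]
    have eq: "(\<integral>\<^sup>+ E. (if \<tau> + E > \<Lambda> then 0 else ennreal (exp (- u * (\<Lambda> - (\<tau> + E))))) \<partial>waiting_time C)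
      = ennreal (?r / (?r - u) * (exp (- u * (\<Lambda> - \<tau>)) - exp (- ?r * (\<Lambda> - \<tau>))))"
      by simp
    have "exp (- ?r * (\<Lambda> - \<tau>)) \<le> exp (- u * (\<Lambda> - \<tau>))"
      using u \<open>\<tau> \<le> \<Lambda>\<close> by (simp add: mult_right_mono)
    moreover have "(1 - u / ?r) * (?r / (?r - u)) = 1"
      using r False by (simp add: field_simps)
    ultimately show ?thesis
      unfolding eq using r u
      apply (subst ennreal_mult'[symmetric])
       apply simp
      apply (subst ennreal_plus[symmetric])
        apply (simp_all only: mult.assoc[symmetric])
        apply simp_all
      done
  qed
  finally show ?thesis .
qed

subsection \<open>The probability that the cell of a point covers a box\<close>

definition cover :: "nat \<Rightarrow> real \<Rightarrow> real \<Rightarrow> 'd::finite cell \<Rightarrow> real ^ 'd \<Rightarrow> real ^ 'd \<Rightarrow> real ^ 'd \<Rightarrow> ennreal" where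
  "cover n \<Lambda> \<tau> C x lo hi =
    (\<integral>\<^sup>+ T. indicator (cells_around lo hi) (leaf_cell T C x) \<partial>mondrian_upto n \<Lambda> \<tau> C)"

lemma measurable_cover_event:
  "(\<lambda>T. indicator (cells_around lo hi) (leaf_cell T C x) :: ennreal) \<in> borel_measurable split_tree_space"
  by (rule measurable_compose[OF _ borel_measurable_indicator[OF cells_around_borel]]) measurable

lemma measurable_nn_integral_cover:
  assumes "K \<in> M \<rightarrow>\<^sub>M subprob_algebra split_tree_space"
  shows "(\<lambda>\<omega>. \<integral>\<^sup>+ T. indicator (cells_around lo hi) (leaf_cell T C x) \<partial>K \<omega>) \<in> borel_measurable M"
  using nn_integral_measurable_subprob_algebra[OF measurable_cover_event] assms
  by (rule measurable_compose[rotated])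

lemma emeasure_mondrian_upto_le: "emeasure (mondrian_upto n \<Lambda> \<tau> C) A \<le> 1"
  by (rule subprob_space.subprob_emeasure_le_1[OF subprob_space_mondrian_upto])

lemma cover_le_mass: "cover n \<Lambda> \<tau> C x lo hi \<le> emeasure (mondrian_upto n \<Lambda> \<tau> C) UNIV"
proof -
  have "cover n \<Lambda> \<tau> C x lo hi \<le> (\<integral>\<^sup>+ T. 1 \<partial>mondrian_upto n \<Lambda> \<tau> C)"
    unfolding cover_def by (intro nn_integral_mono) (simp add: indicator_def)
  then show ?thesis by simp
qed

text \<open>The subtrees are independent and only the near one decides the event, so the integral
  factors. The far factor is a mass that may be below 1 because of the truncation.\<close>

lemma graft_cover:
  "(\<integral>\<^sup>+ T. indicator (cells_around lo hi) (leaf_cell T C x) \<partial>graft n \<Lambda> C t J s) =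
    cover n \<Lambda> t (near_cell C J s x) x lo hi * emeasure (mondrian_upto n \<Lambda> t (far_cell C J s x)) UNIV"
proof (cases "x $ J \<le> s")
  case True
  then show ?thesis
    by (simp add: nn_integral_graft[OF measurable_cover_event] cover_def near_cell_def far_cell_def
      nn_integral_multc measurable_cover_event cong: measurable_cong_sets)
next
  case False
  then show ?thesis
    by (simp add: nn_integral_graft[OF measurable_cover_event] cover_def near_cell_def far_cell_def)
qed

lemma cover_Suc:
  "cover (Suc n) \<Lambda> \<tau> C x lo hi =
    (\<integral>\<^sup>+ E. (if \<tau> + E > \<Lambda> then indicator (cells_around lo hi) C else
      (\<integral>\<^sup>+ T. indicator (cells_around lo hi) (leaf_cell T C x) \<partial>split_law n \<Lambda> C (\<tau> + E))) \<partial>waiting_time C)"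
  by (simp add: cover_def nn_integral_mondrian_upto_Suc[OF measurable_cover_event] cong: if_cong)

lemma split_law_cover:
  "(\<integral>\<^sup>+ T. indicator (cells_around lo hi) (leaf_cell T C x) \<partial>split_law n \<Lambda> C t) =
    (\<integral>\<^sup>+ J. \<integral>\<^sup>+ s. cover n \<Lambda> t (near_cell C J s x) x lo hi *
      emeasure (mondrian_upto n \<Lambda> t (far_cell C J s x)) UNIV \<partial>split_location C J \<partial>split_coordinate C)"
  by (simp add: nn_integral_split_law[OF measurable_cover_event] graft_cover)

text \<open>Induction on the depth: the far mass is bounded by 1, the near child by the induction
  hypothesis, and averaging over the first split reproduces the exponential by
  \<open>waiting_time_survival\<close>. The indicator covers cells that have already lost the
  box.\<close>

lemma cover_le:
  assumes "proper_cell C" "\<tau> \<le> \<Lambda>" and x: "\<forall>j. lo $ j \<le> x $ j \<and> x $ j \<le> hi $ j"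
  shows "cover n \<Lambda> \<tau> C x lo hi \<le>
    indicator (cells_around lo hi) C * ennreal (exp (- (\<Sum>j\<in>UNIV. hi $ j - lo $ j) * (\<Lambda> - \<tau>)))"
  using assms(1,2)
proof (induction n arbitrary: \<tau> C)
  case 0
  show ?case by (simp add: cover_def)
next
  case (Suc n)
  let ?u = "\<Sum>j\<in>UNIV. hi $ j - lo $ j" and ?I = "indicator (cells_around lo hi) :: _ \<Rightarrow> ennreal"
  note r = split_rate_pos[OF Suc.prems(1)]
  have proper: "fst C $ j < snd C $ j" for j
    using Suc.prems(1) by (auto simp: proper_cell_def)
  have split: "(\<integral>\<^sup>+ T. ?I (leaf_cell T C x) \<partial>split_law n \<Lambda> C t)
      \<le> (\<integral>\<^sup>+ J. \<integral>\<^sup>+ s. ?I (near_cell C J s x) * ennreal (exp (- ?u * (\<Lambda> - t)))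
          \<partial>split_location C J \<partial>split_coordinate C)" if "t \<le> \<Lambda>" for t
    unfolding split_law_cover
  proof (rule nn_integral_mono)
    fix J
    show "(\<integral>\<^sup>+ s. cover n \<Lambda> t (near_cell C J s x) x lo hi *
        emeasure (mondrian_upto n \<Lambda> t (far_cell C J s x)) UNIV \<partial>split_location C J)
      \<le> (\<integral>\<^sup>+ s. ?I (near_cell C J s x) * ennreal (exp (- ?u * (\<Lambda> - t))) \<partial>split_location C J)"
    \<comment> \<open>The induction hypothesis needs a proper child, which is available for almost
      every location.\<close>
    proof (rule nn_integral_mono_AE, use AE_split_location[OF proper[of J]] in eventually_elim)
      case (elim s)
      have "cover n \<Lambda> t (near_cell C J s x) x lo hi * emeasure (mondrian_upto n \<Lambda> t (far_cell C J s x)) UNIV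
          \<le> cover n \<Lambda> t (near_cell C J s x) x lo hi * 1"
        by (intro mult_left_mono emeasure_mondrian_upto_le) simp
      also have "\<dots> \<le> ?I (near_cell C J s x) * ennreal (exp (- ?u * (\<Lambda> - t)))"
        using Suc.IH[OF proper_child(1)[OF Suc.prems(1)] that] elim by simp
      finally show ?case .
    qed
  qed
  show ?case
  proof (cases "C \<in> cells_around lo hi")
    case True
    have u: "0 \<le> ?u"
      using x by (intro sum_nonneg) (metis order_trans diff_ge_0_iff_ge)
    have "?u \<le> split_rate C"
      unfolding split_rate_def
      using True by (intro sum_mono) (auto simp: side_length_def cells_around_def intro!: max.coboundedI2 diff_mono)
    note surv = waiting_time_survival[OF r u this \<open>\<tau> \<le> \<Lambda>\<close>]
    have meas: "(\<lambda>s. ?I (near_cell C J s x)) \<in> borel_measurable borel" for J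
      unfolding near_cell_def by (intro measurable_compose[OF _ borel_measurable_indicator[OF cells_around_borel]]) measurable
    have "cover (Suc n) \<Lambda> \<tau> C x lo hi \<le> (\<integral>\<^sup>+ E. (if \<tau> + E > \<Lambda> then 1 else
      ennreal (1 - ?u / split_rate C) * ennreal (exp (- ?u * (\<Lambda> - (\<tau> + E))))) \<partial>waiting_time C)"
      unfolding cover_Suc
    proof (intro nn_integral_mono)
      fix E
      have "(\<integral>\<^sup>+ T. ?I (leaf_cell T C x) \<partial>split_law n \<Lambda> C (\<tau> + E))
        \<le> ennreal (1 - ?u / split_rate C) * ennreal (exp (- ?u * (\<Lambda> - (\<tau> + E))))" if "\<tau> + E \<le> \<Lambda>"
        using split[OF that] nn_integral_near_cell[OF Suc.prems(1) True x]
        by (simp add: nn_integral_multc meas cong: measurable_cong_sets)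
      then show "(if \<tau> + E > \<Lambda> then ?I C else
          (\<integral>\<^sup>+ T. ?I (leaf_cell T C x) \<partial>split_law n \<Lambda> C (\<tau> + E)))
        \<le> (if \<tau> + E > \<Lambda> then 1 else
          ennreal (1 - ?u / split_rate C) * ennreal (exp (- ?u * (\<Lambda> - (\<tau> + E)))))"
        using True by auto
    qed
    then show ?thesis
      using True surv by simp
  next
    case False
    have "(\<integral>\<^sup>+ s. ?I (near_cell C J s x) * c \<partial>split_location C J) = 0" for J c
    proof -
      have "(\<integral>\<^sup>+ s. ?I (near_cell C J s x) * c \<partial>split_location C J) = (\<integral>\<^sup>+ s. 0 \<partial>split_location C J)"
        by (rule nn_integral_cong_AE, use AE_split_location[OF proper[of J]] in eventually_elim)
          (use near_cell_notin_around[OF False] in simp)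
      then show ?thesis by simp
    qed
    then have "(\<integral>\<^sup>+ T. ?I (leaf_cell T C x) \<partial>split_law n \<Lambda> C t) = 0" if "t \<le> \<Lambda>" for t
      using split[OF that] by simp
    then have "cover (Suc n) \<Lambda> \<tau> C x lo hi = (\<integral>\<^sup>+ E. 0 \<partial>waiting_time C)"
      unfolding cover_Suc using False by (intro nn_integral_cong) auto
    then show ?thesis by simp
  qed
qed

text \<open>Bounds the mass lost by stopping the recursion at depth \<open>n\<close>. Losing mass in either child loses
  it in the parent, hence the factor 2 per level in \<open>defect_step\<close>; the exponent \<open>4 D\<close> makes the
  integral over the waiting time gain a factor 1/4.\<close>

definition defect :: "nat \<Rightarrow> real \<Rightarrow> real \<Rightarrow> real" where
  "defect n D T = (1/2) ^ n * exp (4 * D * T)"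

lemma defect_step:
  assumes r: "split_rate C > 0" "split_rate C \<le> D" and "\<tau> \<le> \<Lambda>"
  shows "(\<integral>\<^sup>+ E. (if \<tau> + E > \<Lambda> then 0 else 2 * ennreal (defect n D (\<Lambda> - (\<tau> + E)))) \<partial>waiting_time C)
    \<le> ennreal (defect (Suc n) D (\<Lambda> - \<tau>))"
proof -
  let ?r = "split_rate C"
  have "(\<integral>\<^sup>+ E. (if \<tau> + E > \<Lambda> then 0 else 2 * ennreal (defect n D (\<Lambda> - (\<tau> + E)))) \<partial>waiting_time C)
    = (\<integral>\<^sup>+ E. ennreal (2 * (1/2) ^ n) * (if \<tau> + E > \<Lambda> then 0 else ennreal (exp (4 * D * (\<Lambda> - (\<tau> + E)))))
        \<partial>waiting_time C)"
    by (intro nn_integral_cong) (auto simp: defect_def ennreal_mult mult.assoc)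
  also have "\<dots> = ennreal (2 * (1/2) ^ n) *
      ennreal (?r / (?r + 4 * D) * (exp (4 * D * (\<Lambda> - \<tau>)) - exp (- ?r * (\<Lambda> - \<tau>))))"
    using assms by (subst nn_integral_cmult) (simp, subst nn_integral_waiting_time_exp, auto)
  also have "\<dots> = ennreal (2 * (1/2) ^ n * (?r / (?r + 4 * D) * (exp (4 * D * (\<Lambda> - \<tau>)) - exp (- ?r * (\<Lambda> - \<tau>)))))"
    by (subst ennreal_mult'[symmetric]) auto
  also have "\<dots> \<le> ennreal (defect (Suc n) D (\<Lambda> - \<tau>))"
  proof (rule ennreal_leI)
    have "- ?r * (\<Lambda> - \<tau>) \<le> 0" "0 \<le> 4 * D * (\<Lambda> - \<tau>)"
      using assms by simp_all
    then have "exp (- ?r * (\<Lambda> - \<tau>)) \<le> exp (4 * D * (\<Lambda> - \<tau>))"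
      unfolding exp_le_cancel_iff by linarith
    \<comment> \<open>Since \<open>?r \<le> D\<close>, the prefactor is at most 1/4. Together with
      the factor 2 for the two children, the defect is halved per level.\<close>
    then have "?r / (?r + 4 * D) * (exp (4 * D * (\<Lambda> - \<tau>)) - exp (- ?r * (\<Lambda> - \<tau>)))
      \<le> 1/4 * exp (4 * D * (\<Lambda> - \<tau>))"
      using r by (intro mult_mono) (simp_all add: divide_simps)
    then have "2 * (1/2) ^ n * (?r / (?r + 4 * D) * (exp (4 * D * (\<Lambda> - \<tau>)) - exp (- ?r * (\<Lambda> - \<tau>))))
      \<le> 2 * (1/2) ^ n * (1/4 * exp (4 * D * (\<Lambda> - \<tau>)))"
      by (intro mult_left_mono) auto
    then show "2 * (1/2) ^ n * (?r / (?r + 4 * D) * (exp (4 * D * (\<Lambda> - \<tau>)) - exp (- ?r * (\<Lambda> - \<tau>))))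
      \<le> defect (Suc n) D (\<Lambda> - \<tau>)"
      by (simp add: defect_def)
  qed
  finally show ?thesis .
qed

text \<open>Used with \<open>f\<close> the cover of the near cell, \<open>m\<close> the mass of the
  far cell and \<open>c\<close> the defect: if each factor falls short by at most \<open>c\<close>,
  the product falls short by at most \<open>2 * c\<close>.\<close>

lemma ennreal_defect_mult:
  fixes F f m c :: ennreal
  assumes "F \<le> f + c" "1 \<le> m + c" "f \<le> 1"
  shows "F \<le> f * m + 2 * c"
proof -
  have "F \<le> f * 1 + c" using assms by simp
  also have "\<dots> \<le> f * (m + c) + c"
    using assms by (intro add_mono mult_left_mono) auto
  also have "\<dots> = f * m + f * c + c"
    by (simp add: distrib_left)
  also have "\<dots> \<le> f * m + 1 * c + c"
    using assms by (intro add_mono mult_right_mono) auto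
  finally show ?thesis by (simp add: mult_2 add.assoc)
qed

text \<open>The box varies in the induction because the mass of the far cell is bounded below by the instance
  where the box is a single point.\<close>

lemma cover_ge:
  assumes "proper_cell C" "\<tau> \<le> \<Lambda>" and x: "\<forall>j. lo $ j \<le> x $ j \<and> x $ j \<le> hi $ j"
    and "split_rate C \<le> D" "C \<in> cells_around lo hi"
  shows "ennreal (exp (- (\<Sum>j\<in>UNIV. hi $ j - lo $ j) * (\<Lambda> - \<tau>)))
    \<le> cover n \<Lambda> \<tau> C x lo hi + ennreal (defect n D (\<Lambda> - \<tau>))"
  using assms
proof (induction n arbitrary: \<tau> C x lo hi)
  case 0
  \<comment> \<open>At depth 0 \<open>cover\<close> vanishes, but the defect alone is at least 1 and
    so dominates the left-hand side.\<close>
  have "0 \<le> (\<Sum>j\<in>UNIV. hi $ j - lo $ j)"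
    using 0 by (intro sum_nonneg) (metis order_trans diff_ge_0_iff_ge)
  moreover have "D \<ge> 0"
    using 0 split_rate_pos[of C] by linarith
  ultimately have "exp (- (\<Sum>j\<in>UNIV. hi $ j - lo $ j) * (\<Lambda> - \<tau>)) \<le> exp (4 * D * (\<Lambda> - \<tau>))"
    using 0 by (intro exp_le_cancel_iff[THEN iffD2] mult_right_mono) auto
  then show ?case by (simp add: cover_def defect_def ennreal_leI)
next
  case (Suc n)
  note C = Suc.prems(1,5) and x = Suc.prems(3) and D = Suc.prems(4)
  let ?u = "\<Sum>j\<in>UNIV. hi $ j - lo $ j" and ?I = "indicator (cells_around lo hi) :: _ \<Rightarrow> ennreal"
  note r = split_rate_pos[OF C(1)]
  have proper: "fst C $ j < snd C $ j" for j
    using C by (auto simp: proper_cell_def)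
  have u: "0 \<le> ?u"
    using x by (intro sum_nonneg) (metis order_trans diff_ge_0_iff_ge)
  have ur: "?u \<le> split_rate C"
    unfolding split_rate_def
    using C(2) by (intro sum_mono) (auto simp: side_length_def cells_around_def intro!: max.coboundedI2 diff_mono)
  have meas: "(\<lambda>s. ?I (near_cell C J s x)) \<in> borel_measurable borel" for J
    unfolding near_cell_def by (intro measurable_compose[OF _ borel_measurable_indicator[OF cells_around_borel]]) measurable
  let ?G = "\<lambda>t J s. \<integral>\<^sup>+ T. ?I (leaf_cell T C x) \<partial>graft n \<Lambda> C t J s"
  let ?H = "\<lambda>t. \<integral>\<^sup>+ T. ?I (leaf_cell T C x) \<partial>split_law n \<Lambda> C t"
  have measG: "(\<lambda>s. ?G t J s) \<in> borel_measurable borel" for t J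
    by (intro measurable_nn_integral_cover) measurable
  have measH: "(\<lambda>E. ?H (\<tau> + E)) \<in> borel_measurable borel"
    by (intro measurable_nn_integral_cover) measurable
  have split: "ennreal (1 - ?u / split_rate C) * ennreal (exp (- ?u * (\<Lambda> - t)))
      \<le> ?H t + 2 * ennreal (defect n D (\<Lambda> - t))" if t: "t \<le> \<Lambda>" for t
  proof -
    let ?c = "ennreal (defect n D (\<Lambda> - t))"
    have "ennreal (1 - ?u / split_rate C) * ennreal (exp (- ?u * (\<Lambda> - t)))
      = (\<integral>\<^sup>+ J. \<integral>\<^sup>+ s. ?I (near_cell C J s x) * ennreal (exp (- ?u * (\<Lambda> - t)))
          \<partial>split_location C J \<partial>split_coordinate C)"
      using nn_integral_near_cell[OF C x]
      by (simp add: nn_integral_multc meas cong: measurable_cong_sets)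
    also have "\<dots> \<le> (\<integral>\<^sup>+ J. (\<integral>\<^sup>+ s. ?G t J s \<partial>split_location C J) + 2 * ?c \<partial>split_coordinate C)"
    proof (rule nn_integral_mono)
      fix J
      \<comment> \<open>Total mass 1 is used to integrate the constant \<open>2 * ?c\<close> to
        itself.\<close>
      interpret L: prob_space "split_location C J"
        by (rule prob_space_split_location[OF proper])
      have "(\<integral>\<^sup>+ s. ?I (near_cell C J s x) * ennreal (exp (- ?u * (\<Lambda> - t))) \<partial>split_location C J)
        \<le> (\<integral>\<^sup>+ s. ?G t J s + 2 * ?c \<partial>split_location C J)"
      proof (rule nn_integral_mono_AE, use AE_split_location[OF proper[of J]] in eventually_elim)
        case (elim s)
        note child = proper_child[OF C(1) conjunct1[OF elim] conjunct2[OF elim], of x]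
          and rate = split_rate_child[OF conjunct1[OF elim] conjunct2[OF elim], of x]
        show ?case
        proof (cases "near_cell C J s x \<in> cells_around lo hi")
          case True
          have "ennreal (exp (- ?u * (\<Lambda> - t))) \<le> cover n \<Lambda> t (near_cell C J s x) x lo hi + ?c"
            using Suc.IH[OF child(1) t x _ True] rate D by simp
          moreover have "1 \<le> emeasure (mondrian_upto n \<Lambda> t (far_cell C J s x)) UNIV + ?c"
          proof -
            \<comment> \<open>The lower corner serves as a point of the far cell. A one-point box
              has \<open>u = 0\<close>, so its covering bound is a bound on the total mass.\<close>
            let ?y = "fst (far_cell C J s x)"
            have "far_cell C J s x \<in> cells_around ?y ?y"
              using child(2) by (auto simp: cells_around_def proper_cell_def less_imp_le)
            then have "1 \<le> cover n \<Lambda> t (far_cell C J s x) ?y ?y ?y + ?c"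
              using Suc.IH[OF child(2) t, of ?y ?y ?y] rate D by simp
            also have "\<dots> \<le> emeasure (mondrian_upto n \<Lambda> t (far_cell C J s x)) UNIV + ?c"
              by (intro add_mono cover_le_mass order_refl)
            finally show ?thesis .
          qed
          moreover have "cover n \<Lambda> t (near_cell C J s x) x lo hi \<le> 1"
            by (rule order_trans[OF cover_le_mass emeasure_mondrian_upto_le])
          ultimately show ?thesis
            using True by (simp add: graft_cover ennreal_defect_mult)
        qed simp
      qed
      also have "\<dots> = (\<integral>\<^sup>+ s. ?G t J s \<partial>split_location C J) + 2 * ?c"
        using L.emeasure_space_1
        by (subst nn_integral_add) (simp_all add: measG cong: measurable_cong_sets)
      finally show "(\<integral>\<^sup>+ s. ?I (near_cell C J s x) * ennreal (exp (- ?u * (\<Lambda> - t))) \<partial>split_location C J)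
        \<le> (\<integral>\<^sup>+ s. ?G t J s \<partial>split_location C J) + 2 * ?c" .
    qed
    also have "\<dots> = ?H t + 2 * ?c"
      using prob_space.emeasure_space_1[OF prob_space_split_coordinate[OF r]]
      by (subst nn_integral_add) (simp_all add: nn_integral_split_law[OF measurable_cover_event]
        cong: measurable_cong_sets)
    finally show ?thesis .
  qed
  have "ennreal (exp (- ?u * (\<Lambda> - \<tau>))) = (\<integral>\<^sup>+ E. (if \<tau> + E > \<Lambda> then 1 else
      ennreal (1 - ?u / split_rate C) * ennreal (exp (- ?u * (\<Lambda> - (\<tau> + E))))) \<partial>waiting_time C)"
    by (rule waiting_time_survival[OF r u ur \<open>\<tau> \<le> \<Lambda>\<close>, symmetric])
  also have "\<dots> \<le> (\<integral>\<^sup>+ E. (if \<tau> + E > \<Lambda> then ?I C else ?H (\<tau> + E)) +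
      (if \<tau> + E > \<Lambda> then 0 else 2 * ennreal (defect n D (\<Lambda> - (\<tau> + E)))) \<partial>waiting_time C)"
    using split C(2) by (intro nn_integral_mono) (auto simp: not_less)
  also have "\<dots> = cover (Suc n) \<Lambda> \<tau> C x lo hi +
      (\<integral>\<^sup>+ E. (if \<tau> + E > \<Lambda> then 0 else 2 * ennreal (defect n D (\<Lambda> - (\<tau> + E)))) \<partial>waiting_time C)"
    unfolding cover_Suc
  proof (rule nn_integral_add)
    show "(\<lambda>E. if \<tau> + E > \<Lambda> then ?I C else ?H (\<tau> + E)) \<in> borel_measurable (waiting_time C)"
      using measH by (simp cong: measurable_cong_sets)
    show "(\<lambda>E. if \<tau> + E > \<Lambda> then 0 else 2 * ennreal (defect n D (\<Lambda> - (\<tau> + E)))) \<in> borel_measurable (waiting_time C)"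
      unfolding defect_def by measurable
  qed
  also have "\<dots> \<le> cover (Suc n) \<Lambda> \<tau> C x lo hi + ennreal (defect (Suc n) D (\<Lambda> - \<tau>))"
    by (intro add_left_mono defect_step[OF r D \<open>\<tau> \<le> \<Lambda>\<close>])
  finally show ?case .
qed

section \<open>Passage to the full Mondrian law\<close>

lemma space_MP [simp]: "space (MP \<Lambda>) = UNIV"
  using sets_eq_imp_space_eq[OF sets_MP] by simp

lemma finite_measure_MP: "finite_measure (MP \<Lambda> :: 'd::finite split_tree measure)"
proof
  have "emeasure (MP \<Lambda> :: 'd split_tree measure) UNIV \<le> 1"
    using sets.top[of split_tree_space]
    by (subst emeasure_MP) (auto intro!: SUP_least emeasure_mondrian_upto_le)
  then show "emeasure (MP \<Lambda> :: 'd split_tree measure) (space (MP \<Lambda>)) \<noteq> \<infinity>"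
    by (auto simp: top_unique)
qed

lemma measurable_mondrian_cell [measurable]:
  "(\<lambda>T. mondrian_cell T x) \<in> borel_measurable split_tree_space"
  unfolding mondrian_cell_def by measurable

lemma sets_mondrian_cell_around [measurable]:
  "{T. mondrian_cell T x \<in> cells_around lo hi} \<in> sets split_tree_space"
  using measurable_sets[OF measurable_mondrian_cell cells_around_borel, of x lo hi]
  by (simp add: vimage_def)

lemma proper_unit_cell: "proper_cell unit_cell"
  by (simp add: proper_cell_def unit_cell_def)

lemma emeasure_MP_around_eq_SUP:
  "emeasure (MP \<Lambda>) {T. mondrian_cell T x \<in> cells_around lo hi} = (SUP n. cover n \<Lambda> 0 unit_cell x lo hi)"
proof -
  have "emeasure (mondrian_upto n \<Lambda> 0 unit_cell) {T. mondrian_cell T x \<in> cells_around lo hi}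
    = cover n \<Lambda> 0 unit_cell x lo hi" for n
    unfolding cover_def mondrian_cell_def[symmetric]
    by (subst nn_integral_indicator[symmetric])
      (auto simp: sets_mondrian_cell_around indicator_def simp del: nn_integral_indicator intro!: nn_integral_cong)
  then show ?thesis
    by (subst emeasure_MP[OF sets_mondrian_cell_around]) simp
qed

text \<open>The upper bound holds at every depth; the lower bound holds up to a defect that vanishes
  as the depth grows. The case \<open>lo = hi = x\<close> for \<open>x\<close> in the cube shows
  that the limit has full mass 1.\<close>

proposition emeasure_MP_around:
  fixes x :: "real ^ 'd::finite"
  assumes "0 \<le> \<Lambda>" and x: "\<forall>j. lo $ j \<le> x $ j \<and> x $ j \<le> hi $ j"
  shows "emeasure (MP \<Lambda>) {T. mondrian_cell T x \<in> cells_around lo hi} =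
    indicator (cells_around lo hi) (unit_cell :: 'd cell) *
    ennreal (exp (- (\<Sum>j\<in>UNIV. hi $ j - lo $ j) * \<Lambda>))"
proof (rule antisym)
  let ?S = "SUP n. cover n \<Lambda> 0 unit_cell x lo hi"
  let ?F = "ennreal (exp (- (\<Sum>j\<in>UNIV. hi $ j - lo $ j) * \<Lambda>))"
  show "emeasure (MP \<Lambda>) {T. mondrian_cell T x \<in> cells_around lo hi}
      \<le> indicator (cells_around lo hi) (unit_cell :: 'd cell) * ?F"
    using cover_le[OF proper_unit_cell \<open>0 \<le> \<Lambda>\<close> x]
    unfolding emeasure_MP_around_eq_SUP by (intro SUP_least) simp
  have "?F \<le> ?S" if "unit_cell \<in> cells_around lo hi"
  proof (rule LIMSEQ_le_const)
    let ?D = "split_rate (unit_cell :: 'd cell)"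
    \<comment> \<open>The lifetime is fixed, so the exponential factor is constant and the geometric
      factor decides.\<close>
    have "(\<lambda>n. defect n ?D \<Lambda>) \<longlonglongrightarrow> 0"
      unfolding defect_def by (intro tendsto_mult_left_zero LIMSEQ_power_zero) simp
    then have "(\<lambda>n. ?S + ennreal (defect n ?D \<Lambda>)) \<longlonglongrightarrow> ?S + ennreal 0"
      by (intro tendsto_add tendsto_const tendsto_ennrealI)
    then show "(\<lambda>n. ?S + ennreal (defect n ?D \<Lambda>)) \<longlonglongrightarrow> ?S"
      by simp
    have "?F \<le> ?S + ennreal (defect n ?D \<Lambda>)" for n
    proof -
      have "?F \<le> cover n \<Lambda> 0 unit_cell x lo hi + ennreal (defect n ?D \<Lambda>)"
        using cover_ge[OF proper_unit_cell \<open>0 \<le> \<Lambda>\<close> x order_refl that, of n] by simp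
      also have "\<dots> \<le> ?S + ennreal (defect n ?D \<Lambda>)"
        by (intro add_right_mono SUP_upper) simp
      finally show ?thesis .
    qed
    then show "\<exists>N. \<forall>n\<ge>N. ?F \<le> ?S + ennreal (defect n ?D \<Lambda>)"
      by blast
  qed
  then show "indicator (cells_around lo hi) (unit_cell :: 'd cell) * ?F
      \<le> emeasure (MP \<Lambda>) {T. mondrian_cell T x \<in> cells_around lo hi}"
    unfolding emeasure_MP_around_eq_SUP by (simp add: indicator_def)
qed

lemma measure_MP_around:
  fixes x :: "real ^ 'd::finite"
  assumes "0 \<le> \<Lambda>" and "\<forall>j. lo $ j \<le> x $ j \<and> x $ j \<le> hi $ j"
  shows "measure (MP \<Lambda>) {T. mondrian_cell T x \<in> cells_around lo hi} =
    indicator (cells_around lo hi) (unit_cell :: 'd cell) *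
    exp (- (\<Sum>j\<in>UNIV. hi $ j - lo $ j) * \<Lambda>)"
  using emeasure_MP_around[OF assms]
  by (simp add: measure_def indicator_def)

lemma measurable_h_plus [measurable]: "h_plus \<in> borel_measurable (borel :: 'd::finite cell measure)"
  unfolding h_plus_def[abs_def] by measurable

lemma measurable_h_minus [measurable]: "h_minus \<in> borel_measurable (borel :: 'd::finite cell measure)"
  unfolding h_minus_def[abs_def] by measurable

subsection \<open>The aspect ratio\<close>

text \<open>Reaching distance \<open>u\<close> from \<open>x\<close> along an axis is encoded as
  covering a segment, a degenerate box, so that the covering formula applies.\<close>

definition spread_below :: "real ^ 'd::finite \<Rightarrow> 'd \<Rightarrow> real \<Rightarrow> 'd split_tree set" where
  "spread_below x j u = {T. mondrian_cell T x \<in> cells_around (\<chi> i. if i = j then x $ i - u else x $ i) x}"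

definition spread_above :: "real ^ 'd::finite \<Rightarrow> 'd \<Rightarrow> real \<Rightarrow> 'd split_tree set" where
  "spread_above x j u = {T. mondrian_cell T x \<in> cells_around x (\<chi> i. if i = j then x $ i + u else x $ i)}"

lemma sets_spread [measurable]:
  "spread_below x j u \<in> sets split_tree_space" "spread_above x j u \<in> sets split_tree_space"
  by (simp_all add: spread_below_def spread_above_def sets_mondrian_cell_around)

text \<open>The segment has total side length \<open>u\<close>. It may leave the unit cube, where
  the probability is 0, whence only an inequality; for \<open>u > 1\<close> it always does.\<close>

lemma measure_spread_le:
  fixes x :: "real ^ 'd::finite"
  assumes "0 \<le> \<Lambda>" "0 \<le> u" and x: "\<forall>j. 0 \<le> x $ j \<and> x $ j \<le> 1"
  shows "measure (MP \<Lambda>) (spread_below x j u) \<le> (if u > 1 then 0 else exp (- u * \<Lambda>))"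
    and "measure (MP \<Lambda>) (spread_above x j u) \<le> (if u > 1 then 0 else exp (- u * \<Lambda>))"
proof -
  have "(\<Sum>i\<in>UNIV. x $ i - (if i = j then x $ i - u else x $ i)) = (\<Sum>i\<in>UNIV. if i = j then u else 0)"
    by (intro sum.cong) auto
  moreover have "(\<Sum>i\<in>UNIV. (if i = j then x $ i + u else x $ i) - x $ i) = (\<Sum>i\<in>UNIV. if i = j then u else 0)"
    by (intro sum.cong) auto
  ultimately have sums: "(\<Sum>i\<in>UNIV. x $ i - (if i = j then x $ i - u else x $ i)) = u"
    "(\<Sum>i\<in>UNIV. (if i = j then x $ i + u else x $ i) - x $ i) = u"
    by simp_all
  have "unit_cell \<notin> cells_around (\<chi> i. if i = j then x $ i - u else x $ i) x" if "u > 1"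
    using x that by (auto simp: cells_around_def unit_cell_def intro!: exI[of _ j] dest: spec[of _ j])
  then show "measure (MP \<Lambda>) (spread_below x j u) \<le> (if u > 1 then 0 else exp (- u * \<Lambda>))"
    unfolding spread_below_def using assms
    by (subst measure_MP_around) (auto simp: sums indicator_def)
  have "unit_cell \<notin> cells_around x (\<chi> i. if i = j then x $ i + u else x $ i)" if "u > 1"
  proof
    assume "unit_cell \<in> cells_around x (\<chi> i. if i = j then x $ i + u else x $ i)"
    then have "x $ j + u \<le> 1"
      by (auto simp: cells_around_def unit_cell_def dest: spec[of _ j])
    then show False using x[rule_format, of j] that by simp
  qed
  then show "measure (MP \<Lambda>) (spread_above x j u) \<le> (if u > 1 then 0 else exp (- u * \<Lambda>))"
    unfolding spread_above_def using assms
    by (subst measure_MP_around) (auto simp: sums indicator_def)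
qed

text \<open>Avoiding all spread events confines the cell to distance below \<open>u\<close> from
  \<open>x\<close> in both directions of each axis; covering a cube of side \<open>s\<close> bounds
  every side from below.\<close>

lemma aspect_ratio_le:
  fixes x :: "real ^ 'd::finite"
  assumes "0 < s" "T \<notin> (\<Union>j. spread_below x j u \<union> spread_above x j u)"
    and lohi: "\<And>j. lo $ j \<le> x $ j" "\<And>j. x $ j \<le> hi $ j" "\<And>j. hi $ j - lo $ j = s"
    and T: "mondrian_cell T x \<in> cells_around lo hi"
  shows "h_plus (mondrian_cell T x) / h_minus (mondrian_cell T x) \<le> 2 * u / s"
proof -
  let ?C = "mondrian_cell T x"
  have C: "fst ?C $ j \<le> lo $ j" "hi $ j \<le> snd ?C $ j" for j
    using T by (auto simp: cells_around_def)
  have x: "fst ?C $ j \<le> x $ j" "x $ j \<le> snd ?C $ j" for j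
    using C[of j] lohi[of j] by auto
  have below: "x $ j - fst ?C $ j < u" for j
  proof (rule ccontr)
    assume "\<not> ?thesis"
    then have "T \<in> spread_below x j u"
      using x by (auto simp: spread_below_def cells_around_def)
    then show False using assms(2) by blast
  qed
  have above: "snd ?C $ j - x $ j < u" for j
  proof (rule ccontr)
    assume "\<not> ?thesis"
    then have "T \<in> spread_above x j u"
      using x by (auto simp: spread_above_def cells_around_def)
    then show False using assms(2) by blast
  qed
  have "s \<le> side_length ?C j" "side_length ?C j \<le> 2 * u" for j
    using C[of j] lohi[of j] below[of j] above[of j] by (auto simp: side_length_def max_def)
  then have "s \<le> h_minus ?C" "h_plus ?C \<le> 2 * u"
    unfolding h_minus_def h_plus_def by simp_all
  \<comment> \<open>Any single coordinate yields this, since the distance from \<open>x\<close> to a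
    face is nonnegative and below \<open>u\<close>.\<close>
  moreover have "0 < u"
    using below[of undefined] x[of undefined] by linarith
  ultimately show ?thesis
    using \<open>0 < s\<close> by (intro frac_le) auto
qed

section \<open>Elementary estimates on \<delta>\<close>

lemma exp_minus_one_le_half: "exp (-1) \<le> (1/2 :: real)"
proof -
  have "2 \<le> exp (1 :: real)"
    using exp_ge_add_one_self[of "1 :: real"] by simp
  then show ?thesis
    by (simp add: exp_minus divide_simps)
qed

text \<open>These bounds on both logarithms make the claimed aspect ratio at least 5, and leave
  enough room in the exponent of the union bound.\<close>

lemma delta_bounds:
  fixes \<delta> :: real and d :: nat
  assumes "0 < d" "0 < \<delta>" "\<delta> \<le> 1 - (1 - exp (- 1)) ^ d"
  shows "\<delta> < 1" "- ln (1 - \<delta>) \<le> real d" "ln (\<delta> / real d) \<le> -1"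
proof -
  have pos: "0 < (1 - exp (- 1) :: real)" by simp
  have le: "(1 - exp (- 1)) ^ d \<le> 1 - \<delta>" using assms by simp
  then show "\<delta> < 1"
    using zero_less_power[OF pos, of d] by linarith
  \<comment> \<open>Since \<open>exp (- 1) \<le> 1/2\<close>, also
    \<open>exp (- 1) \<le> 1 - exp (- 1)\<close>, and the powers compare.\<close>
  have "exp (- real d) = exp (- 1) ^ d"
    by (simp add: exp_of_nat_mult[symmetric])
  also have "\<dots> \<le> (1 - exp (- 1)) ^ d"
    using exp_minus_one_le_half by (intro power_mono) auto
  also note le
  finally have "- real d \<le> ln (1 - \<delta>)"
    using \<open>\<delta> < 1\<close> by (subst ln_ge_iff) auto
  then show "- ln (1 - \<delta>) \<le> real d" by simp
  \<comment> \<open>Bernoulli's inequality makes the hypothesis linear in \<open>d\<close>.\<close>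
  have "1 + real d * (- exp (- 1)) \<le> (1 + - exp (- 1)) ^ d"
    by (rule Bernoulli_inequality) simp
  then have "\<delta> \<le> real d * exp (- 1)"
    using le by simp
  then have "\<delta> / real d \<le> exp (- 1)"
    using assms by (simp add: divide_simps mult.commute)
  then have "ln (\<delta> / real d) \<le> ln (exp (- 1))"
    using assms by (subst ln_le_cancel_iff) auto
  then show "ln (\<delta> / real d) \<le> -1" by simp
qed

theorem proposition30:
  fixes x :: "real ^ 'd::finite" and \<Lambda> \<delta> :: real
  assumes "\<Lambda> > 0"
    and "\<forall>j. 0 \<le> x $ j \<and> x $ j \<le> 1"
    and "0 < \<delta>" and "\<delta> \<le> 1 - (1 - exp (- 1)) ^ CARD('d)"
  shows "\<P>(T in MP \<Lambda>. h_plus (mondrian_cell T x) / h_minus (mondrian_cell T x)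
            \<le> 5 * real CARD('d) * ln (\<delta> / real CARD('d)) / ln (1 - \<delta>))
         \<ge> 1 - 2 * \<delta>"
proof -
  define d where "d = real CARD('d)"
  \<comment> \<open>Both logarithms are negative; flipping the signs leaves their quotient unchanged
    and makes \<open>y\<close> and \<open>q\<close> positive.\<close>
  define y where "y = - ln (\<delta> / d)"
  define q where "q = - ln (1 - \<delta>)"
  define R where "R = 5 * d * y / q"
  define s where "s = min 1 (q / (d * \<Lambda>))"
  \<comment> \<open>Chosen so that the bound \<open>2 * u / s\<close> of
    \<open>aspect_ratio_le\<close> is exactly \<open>R\<close>.\<close>
  define u where "u = R * s / 2"
  have d: "d > 0" by (simp add: d_def)
  have \<delta>: "\<delta> < 1" and q: "q \<le> d" and y: "1 \<le> y"
    using delta_bounds[of "CARD('d)" \<delta>] assms by (simp_all add: d_def q_def y_def)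
  have q0: "q > 0"
    using \<open>0 < \<delta>\<close> \<delta> by (simp add: q_def)
  have R: "R \<ge> 5"
  proof -
    have "q \<le> d * y" using q y d by (metis mult_left_mono mult.right_neutral order_trans less_imp_le)
    then show ?thesis using q0 by (simp add: R_def divide_simps)
  qed
  have s: "0 < s" "s \<le> 1" "s * (d * \<Lambda>) \<le> q"
    using q0 d \<open>\<Lambda> > 0\<close> by (auto simp: s_def min_def divide_simps)
  interpret finite_measure "MP \<Lambda> :: 'd split_tree measure" by (rule finite_measure_MP)
  note sets_MP[simp, measurable_cong]
  \<comment> \<open>The cube ends at \<open>x\<close> unless that would cross the face at 0, in
    which case it is shifted up to start there; \<open>s \<le> 1\<close> keeps it inside the unit
    cube.\<close>
  define lo where "lo = (\<chi> j. max 0 (x $ j - s))"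
  define hi where "hi = (\<chi> j. lo $ j + s)"
  have lohi: "lo $ j \<le> x $ j" "x $ j \<le> hi $ j" "hi $ j - lo $ j = s" "0 \<le> lo $ j" "hi $ j \<le> 1" for j
    using assms(2)[rule_format, of j] s by (auto simp: lo_def hi_def max_def)
  define G where "G = {T. mondrian_cell T x \<in> cells_around lo hi}"
  define N where "N = (\<Union>j. spread_below x j u \<union> spread_above x j u)"
  have [measurable]: "G \<in> sets split_tree_space" "N \<in> sets split_tree_space"
    unfolding G_def N_def by measurable
  have "measure (MP \<Lambda>) G = exp (- (s * (d * \<Lambda>)))"
    unfolding G_def using lohi \<open>\<Lambda> > 0\<close>
    by (subst measure_MP_around) (auto simp: cells_around_def unit_cell_def d_def mult_ac)
  also have "\<dots> \<ge> exp (- q)"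
    using s by simp
  also have "exp (- q) = 1 - \<delta>"
    using \<delta> by (simp add: q_def)
  finally have G: "1 - \<delta> \<le> measure (MP \<Lambda>) G" .
  have u0: "0 \<le> u"
    using R s by (simp add: u_def)
  have tail: "(if u > 1 then 0 else exp (- u * \<Lambda>)) \<le> \<delta> / (2 * d)"
  proof (cases "u > 1")
    case True
    then show ?thesis using d \<open>0 < \<delta>\<close> by simp
  next
    case False
    \<comment> \<open>For \<open>s = 1\<close> one would have
      \<open>u = R / 2 \<ge> 5/2\<close>.\<close>
    then have "s \<noteq> 1" using R by (auto simp: u_def)
    then have "s = q / (d * \<Lambda>)" by (auto simp: s_def min_def split: if_splits)
    then have "u * \<Lambda> = 5 / 2 * y"
      using d q0 \<open>\<Lambda> > 0\<close> by (simp add: u_def R_def)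
    \<comment> \<open>Here the constant 5 pays off: \<open>5/2 * y \<ge> 1 + y\<close> because
      \<open>y \<ge> 1\<close>. The part \<open>exp (- y)\<close> is \<open>\<delta> / d\<close>,
      and the extra \<open>exp (- 1)\<close> absorbs the factor 2 from the two directions per
      axis.\<close>
    then have "exp (- u * \<Lambda>) \<le> exp (- 1 + - y)"
      using y by simp
    also have "\<dots> = exp (- 1) * (\<delta> / d)"
      using d \<open>0 < \<delta>\<close> by (simp only: exp_add) (simp add: y_def)
    also have "\<dots> \<le> 1 / 2 * (\<delta> / d)"
      using d \<open>0 < \<delta>\<close> exp_minus_one_le_half by (intro mult_right_mono) auto
    finally show ?thesis using False by simp
  qed
  have "measure (MP \<Lambda>) N \<le> (\<Sum>j\<in>UNIV. measure (MP \<Lambda>) (spread_below x j u \<union> spread_above x j u))"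
    unfolding N_def by (intro finite_measure_subadditive_finite) auto
  also have "\<dots> \<le> (\<Sum>j\<in>(UNIV :: 'd set). \<delta> / (2 * d) + \<delta> / (2 * d))"
  proof (rule sum_mono)
    fix j
    have "measure (MP \<Lambda>) (spread_below x j u \<union> spread_above x j u)
      \<le> measure (MP \<Lambda>) (spread_below x j u) + measure (MP \<Lambda>) (spread_above x j u)"
      by (intro measure_Un_le) auto
    also have "\<dots> \<le> \<delta> / (2 * d) + \<delta> / (2 * d)"
      using \<open>\<Lambda> > 0\<close> u0 assms(2) by (intro add_mono order_trans[OF measure_spread_le(1) tail]
        order_trans[OF measure_spread_le(2) tail]) auto
    finally show "measure (MP \<Lambda>) (spread_below x j u \<union> spread_above x j u) \<le> \<dots>" .
  qed
  also have "\<dots> = \<delta>"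
    using d by (simp add: d_def)
  finally have N: "measure (MP \<Lambda>) N \<le> \<delta>" .
  let ?E = "{T \<in> space (MP \<Lambda>). h_plus (mondrian_cell T x) / h_minus (mondrian_cell T x) \<le> R}"
  have "G - N \<subseteq> ?E"
  proof
    fix T assume "T \<in> G - N"
    then have "h_plus (mondrian_cell T x) / h_minus (mondrian_cell T x) \<le> 2 * u / s"
      using lohi s by (intro aspect_ratio_le[of s T x u lo hi]) (auto simp: G_def N_def)
    then show "T \<in> ?E" using s by (simp add: u_def)
  qed
  have "1 - 2 * \<delta> \<le> measure (MP \<Lambda>) G - measure (MP \<Lambda>) N"
    using G N by simp
  \<comment> \<open>Subadditivity on \<open>G\<close>, which lies in the union of
    \<open>G - N\<close> and \<open>N\<close>.\<close>
  also have "\<dots> \<le> measure (MP \<Lambda>) (G - N)"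
    using finite_measure_mono[of G "(G - N) \<union> N"] measure_Un_le[of "G - N" "MP \<Lambda>" N] by auto
  also have "\<dots> \<le> measure (MP \<Lambda>) ?E"
  proof (rule finite_measure_mono[OF \<open>G - N \<subseteq> ?E\<close>])
    show "?E \<in> sets (MP \<Lambda>)" by measurable
  qed
  also have "R = 5 * real CARD('d) * ln (\<delta> / real CARD('d)) / ln (1 - \<delta>)"
    by (simp add: R_def y_def q_def d_def)
  finally show ?thesis .
qed

end
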